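(* Let $\mathcal L$ denote the set of isotropic subbundles $L\subset E$ mapping isomorphically to $T^{0,1}X$ under $\pi:E\to T\underline X\otimes\mathbb C$, and let $\mathcal W$ denote the set of horizontal lifts $W\subset E_{\mathbb R}$ of $T\underline X$ to $E_{\mathbb R}$ such that $$L_W:=\{e\in W\otimes\mathbb C\;|\;\pi(e)\in T^{0,1}X\}\subset E$$ is isotropic. Then the map $$\mathcal W\to\mathcal L,\qquad W\mapsto L_W$$ is a bijection.
   Context: $X$ is a compact complex manifold with underlying smooth manifold $\underline X$. $K$ is a compact Lie group with an invariant non-degenerate real symmetric bilinear form $\langle,\rangle$ on $\mathfrak k$, and $G$ is its complexification, with the form extended complex-bilinearly to $\mathfrak g$. A smooth (real) Courant algebroid over $\underline X$ is a smooth vector bundle $E_{\mathbb R}$ with a non-degenerate symmetric bilinear form $\langle,\rangle$, an anchor map $\pi:E_{\mathbb R}\to T\underline X$ and a bracket $[,]$ on sections such that, for sections $u,v,w$ and functions $\phi$: $[u,[v,w]]=[[u,v],w]+[v,[u,w]]$; $\pi([u,v])=[\pi(u),\pi(v)]$; $[u,\phi v]=\pi(u)(\phi)v+\phi[u,v]$; $\pi(u)\langle v,w\rangle=\langle[u,v],w\rangle+\langle v,[u,w]\rangle$; $[u,v]+[v,u]=\mathcal D\langle u,v\rangle$, where $\mathcal D\phi$ is the image of $d\phi$ under $\pi^*$ and $E_{\mathbb R}^*\cong E_{\mathbb R}$. $E_{\mathbb R}$ is a real string algebroid $(E_{\mathbb R},P_{\mathbb R},\rho_{\mathbb R})$: $P_{\mathbb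 R}$ is a smooth principal $K$-bundle over $\underline X$, $E_{\mathbb R}$ a smooth Courant algebroid, $\rho_{\mathbb R}:E_{\mathbb R}\to A_{P_{\mathbb R}}=TP_{\mathbb R}/K$ bracket-preserving with $0\to T^*\underline X\to E_{\mathbb R}\to A_{P_{\mathbb R}}\to0$ exact, inducing an isomorphism of Lie algebroids $E_{\mathbb R}/(\ker\pi)^\perp\cong A_{P_{\mathbb R}}$ which restricts to an isometry $\ker\pi/(\ker\pi)^\perp\cong(\operatorname{ad}P_{\mathbb R},\langle,\rangle)$. $E=E_{\mathbb R}\otimes\mathbb C$ is the complexification of $E_{\mathbb R}$, with $\mathbb C$-bilinearly extended pairing, bracket and anchor, and underlying principal $G$-bundle $P_{\mathbb R}\times_KG$. A horizontal lift of $T\underline X$ to $E_{\mathbb R}$ is a subbundle $W\subset E_{\mathbb R}$ with $\operatorname{rk}W=\dim_{\mathbb R}\underline X$ and $W\cap\ker\pi=\{0\}$. *)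

theory Defs
  imports
    "HOL-Analysis.Analysis"
    "HOL-Algebra.Group"
    "HOL-Library.Function_Algebras"
begin

section \<open>Linear algebra on fibres\<close>

instantiation "fun" :: (type, scaleR) scaleR
begin
definition scaleR_fun_def: "r *\<^sub>R f = (\<lambda>x. r *\<^sub>R f x)"
instance ..
end

instance "fun" :: (type, real_vector) real_vector
  by standard (simp_all add: scaleR_fun_def fun_eq_iff scaleR_add_right scaleR_add_left)

definition linear_map_on :: "'a::real_vector set \<Rightarrow> ('a \<Rightarrow> 'b::real_vector) \<Rightarrow> bool" where
  "linear_map_on V f \<longleftrightarrow>
     (\<forall>u\<in>V. \<forall>v\<in>V. f (u + v) = f u + f v) \<and> (\<forall>r. \<forall>u\<in>V. f (r *\<^sub>R u) = r *\<^sub>R f u)"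

definition nondegenerate_form_on :: "'a::real_vector set \<Rightarrow> ('a \<Rightarrow> 'a \<Rightarrow> real) \<Rightarrow> bool" where
  "nondegenerate_form_on V B \<longleftrightarrow>
     (\<forall>u\<in>V. linear_map_on V (B u)) \<and>
     (\<forall>u\<in>V. \<forall>v\<in>V. B u v = B v u) \<and>
     (\<forall>u\<in>V. (\<forall>v\<in>V. B u v = 0) \<longrightarrow> u = 0)"

text \<open>The complexification of a real vector space \<open>V\<close> is \<open>V \<times> V\<close>, the pair \<open>(a, b)\<close> standing
  for \<open>a + i b\<close>.\<close>

definition cscale :: "complex \<Rightarrow> 'a::real_vector \<times> 'a \<Rightarrow> 'a \<times> 'a" where
  "cscale z e = (Re z *\<^sub>R fst e - Im z *\<^sub>R snd e, Re z *\<^sub>R snd e + Im z *\<^sub>R fst e)"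

global_interpretation cvec: vector_space "cscale :: complex \<Rightarrow> 'a::real_vector \<times> 'a \<Rightarrow> _"
  by standard
    (auto simp: cscale_def prod_eq_iff algebra_simps scaleR_add_left scaleR_diff_left)

definition complexify_space :: "'a set \<Rightarrow> ('a \<times> 'a) set" where
  "complexify_space V = V \<times> V"

definition complexify_map :: "('a \<Rightarrow> 'b) \<Rightarrow> 'a \<times> 'a \<Rightarrow> 'b \<times> 'b" where
  "complexify_map f = map_prod f f"

definition complexify_form :: "('a \<Rightarrow> 'a \<Rightarrow> real) \<Rightarrow> 'a \<times> 'a \<Rightarrow> 'a \<times> 'a \<Rightarrow> complex" where
  "complexify_form B e e' =
     Complex (B (fst e) (fst e') - B (snd e) (snd e')) (B (fst e) (snd e') + B (snd e) (fst e'))"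


section \<open>Smooth manifolds\<close>

text \<open>\<open>\<real>\<^sup>n\<close> is the space \<open>Euclidean_space n\<close> of the library: sequences of reals vanishing from index
  \<open>n\<close> on. Thus \<open>n = 0\<close> is allowed (zero-dimensional \<open>K\<close>, in particular), and dimensions can be
  added.\<close>

definition Rn :: "nat \<Rightarrow> (nat \<Rightarrow> real) set" where
  "Rn n = topspace (Euclidean_space n)"

definition basis_vec :: "nat \<Rightarrow> nat \<Rightarrow> real" where
  "basis_vec i = (\<lambda>j. if j = i then 1 else 0)"

definition partial :: "nat \<Rightarrow> ((nat \<Rightarrow> real) \<Rightarrow> real) \<Rightarrow> (nat \<Rightarrow> real) \<Rightarrow> real" where
  "partial i f x = deriv (\<lambda>t. f (x(i := t))) (x i)"

primrec Ck_on :: "nat \<Rightarrow> nat \<Rightarrow> (nat \<Rightarrow> real) set \<Rightarrow> ((nat \<Rightarrow> real) \<Rightarrow> real) \<Rightarrow> bool" where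
  "Ck_on 0 n U f \<longleftrightarrow> continuous_on U f"
| "Ck_on (Suc k) n U f \<longleftrightarrow> continuous_on U f \<and>
     (\<forall>i<n. (\<forall>x\<in>U. (\<lambda>t. f (x(i := t))) differentiable (at (x i))) \<and> Ck_on k n U (partial i f))"

definition Cinf_on :: "nat \<Rightarrow> (nat \<Rightarrow> real) set \<Rightarrow> ((nat \<Rightarrow> real) \<Rightarrow> real) \<Rightarrow> bool" where
  "Cinf_on n U f \<longleftrightarrow> (\<forall>k. Ck_on k n U f)"

type_synonym 'a chart = "'a set \<times> ('a \<Rightarrow> nat \<Rightarrow> real)"

record 'a manifold =
  mtop :: "'a topology"
  mdim :: nat
  atlas :: "'a chart set"

abbreviation pts :: "'a manifold \<Rightarrow> 'a set" where
  "pts M \<equiv> topspace (mtop M)"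

definition is_chart :: "'a topology \<Rightarrow> nat \<Rightarrow> 'a chart \<Rightarrow> bool" where
  "is_chart T n c \<longleftrightarrow> openin T (fst c) \<and> openin (Euclidean_space n) (snd c ` fst c) \<and>
     homeomorphic_map (subtopology T (fst c)) (subtopology (Euclidean_space n) (snd c ` fst c)) (snd c)"

definition smooth_manifold :: "'a manifold \<Rightarrow> bool" where
  "smooth_manifold M \<longleftrightarrow>
     Hausdorff_space (mtop M) \<and> second_countable (mtop M) \<and>
     (\<forall>c\<in>atlas M. is_chart (mtop M) (mdim M) c) \<and>
     \<Union>(fst ` atlas M) = pts M \<and>
     (\<forall>(U, \<phi>)\<in>atlas M. \<forall>(V, \<psi>)\<in>atlas M. \<forall>j<mdim M.
        Cinf_on (mdim M) (\<phi> ` (U \<inter> V)) (\<lambda>y. \<psi> (inv_into U \<phi> y) j))"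

definition smooth_fun_on :: "'a manifold \<Rightarrow> 'a set \<Rightarrow> ('a \<Rightarrow> real) \<Rightarrow> bool" where
  "smooth_fun_on M U f \<longleftrightarrow>
     (\<forall>(V, \<phi>)\<in>atlas M. Cinf_on (mdim M) (\<phi> ` (U \<inter> V)) (\<lambda>y. f (inv_into V \<phi> y)))"

definition smooth_map :: "'a manifold \<Rightarrow> 'b manifold \<Rightarrow> ('a \<Rightarrow> 'b) \<Rightarrow> bool" where
  "smooth_map M N F \<longleftrightarrow> continuous_map (mtop M) (mtop N) F \<and>
     (\<forall>(V, \<psi>)\<in>atlas N. \<forall>j<mdim N. smooth_fun_on M {p \<in> pts M. F p \<in> V} (\<lambda>p. \<psi> (F p) j))"

definition diffeomorphism :: "'a manifold \<Rightarrow> 'b manifold \<Rightarrow> ('a \<Rightarrow> 'b) \<Rightarrow> bool" where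
  "diffeomorphism M N F \<longleftrightarrow> bij_betw F (pts M) (pts N) \<and> smooth_map M N F \<and>
     smooth_map N M (inv_into (pts M) F)"

definition open_submanifold :: "'a manifold \<Rightarrow> 'a set \<Rightarrow> 'a manifold" where
  "open_submanifold M U =
     \<lparr>mtop = subtopology (mtop M) U, mdim = mdim M, atlas = {(V \<inter> U, \<phi>) | V \<phi>. (V, \<phi>) \<in> atlas M}\<rparr>"

definition prod_manifold :: "'a manifold \<Rightarrow> 'b manifold \<Rightarrow> ('a \<times> 'b) manifold" where
  "prod_manifold M N =
     \<lparr>mtop = prod_topology (mtop M) (mtop N), mdim = mdim M + mdim N,
      atlas = {(U \<times> V, \<lambda>(p, q) i. if i < mdim M then \<phi> p i else \<psi> q (i - mdim M)) | U \<phi> V \<psi>.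
                 (U, \<phi>) \<in> atlas M \<and> (V, \<psi>) \<in> atlas N}\<rparr>"

text \<open>A tangent vector at \<open>p\<close> assigns to each chart around \<open>p\<close> its vector of components, and these
  transform by the Jacobian matrices of the coordinate changes; charts not containing \<open>p\<close> get the
  dummy value 0.\<close>

type_synonym 'a tvec = "'a chart \<Rightarrow> nat \<Rightarrow> real"

definition tangent_space :: "'a manifold \<Rightarrow> 'a \<Rightarrow> 'a tvec set" where
  "tangent_space M p =
     {v. (\<forall>c. v c \<in> Rn (mdim M)) \<and>
         (\<forall>c. c \<notin> atlas M \<or> p \<notin> fst c \<longrightarrow> v c = 0) \<and>
         (\<forall>(U, \<phi>)\<in>atlas M. \<forall>(V, \<psi>)\<in>atlas M. p \<in> U \<inter> V \<longrightarrow> (\<forall>j<mdim M.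
            v (V, \<psi>) j =
              (\<Sum>i<mdim M. partial i (\<lambda>y. \<psi> (inv_into U \<phi> y) j) (\<phi> p) * v (U, \<phi>) i)))}"

text \<open>The derivative of a function in the direction of a tangent vector. It does not depend on the
  chart chosen.\<close>

definition dir_deriv :: "'a manifold \<Rightarrow> 'a \<Rightarrow> 'a tvec \<Rightarrow> ('a \<Rightarrow> real) \<Rightarrow> real" where
  "dir_deriv M p v f =
     (let c = (SOME c. c \<in> atlas M \<and> p \<in> fst c)
      in \<Sum>i<mdim M. partial i (\<lambda>y. f (inv_into (fst c) (snd c) y)) (snd c p) * v c i)"

definition differential ::
  "'a manifold \<Rightarrow> 'b manifold \<Rightarrow> ('a \<Rightarrow> 'b) \<Rightarrow> 'a \<Rightarrow> 'a tvec \<Rightarrow> 'b tvec" where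
  "differential M N F p v = (\<lambda>c j.
     if c \<in> atlas N \<and> F p \<in> fst c \<and> j < mdim N then dir_deriv M p v (\<lambda>q. snd c (F q) j) else 0)"

definition cotangent_space :: "'a manifold \<Rightarrow> 'a \<Rightarrow> ('a tvec \<Rightarrow> real) set" where
  "cotangent_space M p = {\<alpha>. linear_map_on (tangent_space M p) \<alpha> \<and> (\<forall>v. v \<notin> tangent_space M p \<longrightarrow> \<alpha> v = 0)}"

definition lie_bracket :: "'a manifold \<Rightarrow> ('a \<Rightarrow> 'a tvec) \<Rightarrow> ('a \<Rightarrow> 'a tvec) \<Rightarrow> 'a \<Rightarrow> 'a tvec" where
  "lie_bracket M X Y p = (\<lambda>c j.
     if c \<in> atlas M \<and> p \<in> fst c \<and> j < mdim M
     then dir_deriv M p (X p) (\<lambda>q. Y q c j) - dir_deriv M p (Y p) (\<lambda>q. X q c j) else 0)"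


section \<open>Vector bundles\<close>

text \<open>The fibres are finite-dimensional subspaces of one arbitrary real vector space \<open>'v\<close>, which only
  serves to provide the fibrewise operations (any family of vector spaces is of this kind, inside
  its direct sum); the smooth structure comes from the trivialisations alone. The total space is the
  disjoint union \<open>Sigma (pts M) (fib E)\<close>.\<close>

record ('x, 'v) vbundle =
  fib :: "'x \<Rightarrow> 'v set"
  rk :: nat
  trivs :: "('x set \<times> ('x \<Rightarrow> 'v \<Rightarrow> nat \<Rightarrow> real)) set"

definition smooth_vbundle :: "'x manifold \<Rightarrow> ('x, 'v::real_vector, 'z) vbundle_scheme \<Rightarrow> bool" where
  "smooth_vbundle M E \<longleftrightarrow>
     (\<forall>x\<in>pts M. subspace (fib E x)) \<and>
     (\<forall>(U, \<Phi>)\<in>trivs E. openin (mtop M) U \<and>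
        (\<forall>x\<in>U. linear_map_on (fib E x) (\<Phi> x) \<and> bij_betw (\<Phi> x) (fib E x) (Rn (rk E)))) \<and>
     \<Union>(fst ` trivs E) = pts M \<and>
     (\<forall>(U, \<Phi>)\<in>trivs E. \<forall>(V, \<Psi>)\<in>trivs E. \<forall>i<rk E. \<forall>j<rk E.
        smooth_fun_on M (U \<inter> V) (\<lambda>x. \<Psi> x (inv_into (fib E x) (\<Phi> x) (basis_vec i)) j))"

definition smooth_section_on ::
  "'x manifold \<Rightarrow> ('x, 'v, 'z) vbundle_scheme \<Rightarrow> 'x set \<Rightarrow> ('x \<Rightarrow> 'v) \<Rightarrow> bool" where
  "smooth_section_on M E U u \<longleftrightarrow> (\<forall>x\<in>U. u x \<in> fib E x) \<and>
     (\<forall>(V, \<Phi>)\<in>trivs E. \<forall>i<rk E. smooth_fun_on M (U \<inter> V) (\<lambda>x. \<Phi> x (u x) i))"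

text \<open>Global sections are extended by 0 off the manifold, so that they are determined by their values
  on it.\<close>

definition sections :: "'x manifold \<Rightarrow> ('x, 'v::zero, 'z) vbundle_scheme \<Rightarrow> ('x \<Rightarrow> 'v) set" where
  "sections M E = {u. smooth_section_on M E (pts M) u \<and> (\<forall>x. x \<notin> pts M \<longrightarrow> u x = 0)}"

definition tangent_bundle :: "'a manifold \<Rightarrow> ('a, 'a tvec) vbundle" where
  "tangent_bundle M =
     \<lparr>fib = tangent_space M, rk = mdim M, trivs = {(fst c, \<lambda>p v. v c) | c. c \<in> atlas M}\<rparr>"

definition smooth_subbundle ::
  "'x manifold \<Rightarrow> ('x, 'v::real_vector, 'z) vbundle_scheme \<Rightarrow> nat \<Rightarrow> ('x \<times> 'v) set \<Rightarrow> bool" where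
  "smooth_subbundle M E k W \<longleftrightarrow> W \<subseteq> Sigma (pts M) (fib E) \<and>
     (\<forall>x\<in>pts M. subspace (W `` {x})) \<and>
     (\<forall>x\<in>pts M. \<exists>U w. openin (mtop M) U \<and> x \<in> U \<and>
        (\<forall>i<k. smooth_section_on M E U (w i)) \<and>
        (\<forall>y\<in>U. inj_on (\<lambda>i. w i y) {..<k} \<and> independent ((\<lambda>i. w i y) ` {..<k}) \<and>
               span ((\<lambda>i. w i y) ` {..<k}) = W `` {y}))"

text \<open>Smooth complex subbundles of \<open>E \<otimes> \<complex>\<close>, whose fibre at \<open>x\<close> is \<open>complexify_space (fib E x)\<close> and
  whose smooth sections are those with smooth real and imaginary part.\<close>

definition smooth_complex_subbundle ::
  "'x manifold \<Rightarrow> ('x, 'v::real_vector, 'z) vbundle_scheme \<Rightarrow> nat \<Rightarrow> ('x \<times> ('v \<times> 'v)) set \<Rightarrow> bool" where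
  "smooth_complex_subbundle M E k L \<longleftrightarrow> L \<subseteq> Sigma (pts M) (\<lambda>x. complexify_space (fib E x)) \<and>
     (\<forall>x\<in>pts M. cvec.subspace (L `` {x})) \<and>
     (\<forall>x\<in>pts M. \<exists>U l. openin (mtop M) U \<and> x \<in> U \<and>
        (\<forall>i<k. smooth_section_on M E U (\<lambda>y. fst (l i y)) \<and> smooth_section_on M E U (\<lambda>y. snd (l i y))) \<and>
        (\<forall>y\<in>U. inj_on (\<lambda>i. l i y) {..<k} \<and> cvec.independent ((\<lambda>i. l i y) ` {..<k}) \<and>
               cvec.span ((\<lambda>i. l i y) ` {..<k}) = L `` {y}))"

text \<open>Smooth vector bundle morphisms over the identity; a fibrewise linear map is smooth iff it takes
  smooth local sections to smooth local sections.\<close>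

definition bundle_map ::
  "'x manifold \<Rightarrow> ('x, 'v::real_vector, 'z) vbundle_scheme \<Rightarrow> ('x, 'w::real_vector, 'y) vbundle_scheme \<Rightarrow>
   ('x \<Rightarrow> 'v \<Rightarrow> 'w) \<Rightarrow> bool" where
  "bundle_map M E F f \<longleftrightarrow>
     (\<forall>x\<in>pts M. linear_map_on (fib E x) (f x) \<and> f x ` fib E x \<subseteq> fib F x) \<and>
     (\<forall>U u. openin (mtop M) U \<and> smooth_section_on M E U u \<longrightarrow>
        smooth_section_on M F U (\<lambda>x. f x (u x)))"


section \<open>Complex manifolds\<close>

record 'a complex_mfd =
  ctop :: "'a topology"
  cdim :: nat
  catlas :: "('a set \<times> ('a \<Rightarrow> nat \<Rightarrow> complex)) set"

text \<open>\<open>z\<^sub>j = x\<^sub>2\<^sub>j + i x\<^sub>2\<^sub>j\<^sub>+\<^sub>1\<close>\<close>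

definition realify :: "(nat \<Rightarrow> complex) \<Rightarrow> nat \<Rightarrow> real" where
  "realify z = (\<lambda>k. if even k then Re (z (k div 2)) else Im (z (k div 2)))"

definition underlying :: "'a complex_mfd \<Rightarrow> 'a manifold" where
  "underlying X = \<lparr>mtop = ctop X, mdim = 2 * cdim X,
     atlas = {(U, \<lambda>p. realify (\<zeta> p)) | U \<zeta>. (U, \<zeta>) \<in> catlas X}\<rparr>"

text \<open>The coordinate changes are smooth and holomorphic in each variable separately.\<close>

definition complex_manifold :: "'a complex_mfd \<Rightarrow> bool" where
  "complex_manifold X \<longleftrightarrow> smooth_manifold (underlying X) \<and>
     (\<forall>(U, \<zeta>)\<in>catlas X. \<forall>(V, \<xi>)\<in>catlas X. \<forall>i<cdim X. \<forall>j<cdim X. \<forall>z\<in>\<zeta> ` (U \<inter> V).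
        (\<lambda>t. \<xi> (inv_into U \<zeta> (z(i := t))) j) field_differentiable (at (z i)))"

text \<open>The complex structure \<open>\<partial>/\<partial>x\<^sub>2\<^sub>j \<mapsto> \<partial>/\<partial>x\<^sub>2\<^sub>j\<^sub>+\<^sub>1\<close>, \<open>\<partial>/\<partial>x\<^sub>2\<^sub>j\<^sub>+\<^sub>1 \<mapsto> - \<partial>/\<partial>x\<^sub>2\<^sub>j\<close> on tangent vectors
  of the underlying smooth manifold, and its \<open>-i\<close>-eigenspace.\<close>

definition cx_structure :: "'a tvec \<Rightarrow> 'a tvec" where
  "cx_structure v = (\<lambda>c k. if even k then - v c (Suc k) else v c (k - 1))"

definition T01 :: "'a complex_mfd \<Rightarrow> 'a \<Rightarrow> ('a tvec \<times> 'a tvec) set" where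
  "T01 X x = {e \<in> complexify_space (tangent_space (underlying X) x).
     complexify_map cx_structure e = cscale (- \<i>) e}"


section \<open>Lie groups and principal bundles\<close>

definition lie_group :: "'k monoid \<Rightarrow> 'k manifold \<Rightarrow> bool" where
  "lie_group K KM \<longleftrightarrow> group K \<and> smooth_manifold KM \<and> pts KM = carrier K \<and>
     smooth_map (prod_manifold KM KM) KM (\<lambda>(g, h). g \<otimes>\<^bsub>K\<^esub> h) \<and>
     smooth_map KM KM (\<lambda>g. inv\<^bsub>K\<^esub> g)"

abbreviation lie_alg :: "'k monoid \<Rightarrow> 'k manifold \<Rightarrow> 'k tvec set" where
  "lie_alg K KM \<equiv> tangent_space KM \<one>\<^bsub>K\<^esub>"

definition Ad :: "'k monoid \<Rightarrow> 'k manifold \<Rightarrow> 'k \<Rightarrow> 'k tvec \<Rightarrow> 'k tvec" where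
  "Ad K KM g = differential KM KM (\<lambda>h. g \<otimes>\<^bsub>K\<^esub> h \<otimes>\<^bsub>K\<^esub> inv\<^bsub>K\<^esub> g) \<one>\<^bsub>K\<^esub>"

definition invariant_form :: "'k monoid \<Rightarrow> 'k manifold \<Rightarrow> ('k tvec \<Rightarrow> 'k tvec \<Rightarrow> real) \<Rightarrow> bool" where
  "invariant_form K KM B \<longleftrightarrow> nondegenerate_form_on (lie_alg K KM) B \<and>
     (\<forall>g\<in>carrier K. \<forall>\<xi>\<in>lie_alg K KM. \<forall>\<eta>\<in>lie_alg K KM. B (Ad K KM g \<xi>) (Ad K KM g \<eta>) = B \<xi> \<eta>)"

record ('p, 'x, 'k) principal =
  ptot :: "'p manifold"
  pproj :: "'p \<Rightarrow> 'x"
  pact :: "'p \<Rightarrow> 'k \<Rightarrow> 'p"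

definition pfib :: "('p, 'x, 'k) principal \<Rightarrow> 'x \<Rightarrow> 'p set" where
  "pfib P x = {p \<in> pts (ptot P). pproj P p = x}"

definition principal_bundle ::
  "'x manifold \<Rightarrow> 'k monoid \<Rightarrow> 'k manifold \<Rightarrow> ('p, 'x, 'k) principal \<Rightarrow> bool" where
  "principal_bundle M K KM P \<longleftrightarrow> smooth_manifold (ptot P) \<and>
     smooth_map (ptot P) M (pproj P) \<and>
     smooth_map (prod_manifold (ptot P) KM) (ptot P) (\<lambda>(p, g). pact P p g) \<and>
     (\<forall>p\<in>pts (ptot P). pact P p \<one>\<^bsub>K\<^esub> = p) \<and>
     (\<forall>p\<in>pts (ptot P). \<forall>g\<in>carrier K. \<forall>h\<in>carrier K. pact P (pact P p g) h = pact P p (g \<otimes>\<^bsub>K\<^esub> h)) \<and>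
     (\<forall>p\<in>pts (ptot P). \<forall>g\<in>carrier K. pproj P (pact P p g) = pproj P p) \<and>
     (\<forall>x\<in>pts M. \<exists>U \<tau>. openin (mtop M) U \<and> x \<in> U \<and>
        diffeomorphism (open_submanifold (ptot P) {p \<in> pts (ptot P). pproj P p \<in> U})
          (prod_manifold (open_submanifold M U) KM) (\<lambda>p. (pproj P p, \<tau> p)) \<and>
        (\<forall>p\<in>pts (ptot P). pproj P p \<in> U \<longrightarrow> (\<forall>g\<in>carrier K. \<tau> (pact P p g) = \<tau> p \<otimes>\<^bsub>K\<^esub> g)))"

text \<open>The Atiyah algebroid \<open>TP/K\<close>. A \<open>K\<close>-orbit in \<open>TP\<close> over \<open>x\<close> is the graph of a \<open>K\<close>-invariant vector
  field along the fibre \<open>P\<^sub>x\<close>, since \<open>K\<close> acts simply transitively there; this vector field, extended by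
  0, represents the orbit. A section of \<open>TP/K\<close> thus yields an invariant vector field on \<open>P\<close>, which
  defines smoothness and the bracket.\<close>

definition atiyah_fib :: "'k monoid \<Rightarrow> ('p, 'x, 'k) principal \<Rightarrow> 'x \<Rightarrow> ('p \<Rightarrow> 'p tvec) set" where
  "atiyah_fib K P x =
     {a. (\<forall>p. p \<notin> pfib P x \<longrightarrow> a p = 0) \<and>
         (\<forall>p\<in>pfib P x. a p \<in> tangent_space (ptot P) p \<and>
            (\<forall>g\<in>carrier K. a (pact P p g) =
               differential (ptot P) (ptot P) (\<lambda>q. pact P q g) p (a p)))}"

definition atiyah_field :: "('p, 'x, 'k) principal \<Rightarrow> ('x \<Rightarrow> 'p \<Rightarrow> 'p tvec) \<Rightarrow> 'p \<Rightarrow> 'p tvec" where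
  "atiyah_field P a = (\<lambda>p. a (pproj P p) p)"

definition smooth_atiyah_section_on ::
  "'k monoid \<Rightarrow> ('p, 'x, 'k) principal \<Rightarrow> 'x set \<Rightarrow> ('x \<Rightarrow> 'p \<Rightarrow> 'p tvec) \<Rightarrow> bool" where
  "smooth_atiyah_section_on K P U a \<longleftrightarrow> (\<forall>x\<in>U. a x \<in> atiyah_fib K P x) \<and>
     smooth_section_on (ptot P) (tangent_bundle (ptot P)) {p \<in> pts (ptot P). pproj P p \<in> U}
       (atiyah_field P a)"

definition atiyah_bracket ::
  "('p, 'x, 'k) principal \<Rightarrow> ('x \<Rightarrow> 'p \<Rightarrow> 'p tvec) \<Rightarrow> ('x \<Rightarrow> 'p \<Rightarrow> 'p tvec) \<Rightarrow> 'x \<Rightarrow> 'p \<Rightarrow> 'p tvec" where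
  "atiyah_bracket P a b x = (\<lambda>p.
     if p \<in> pfib P x then lie_bracket (ptot P) (atiyah_field P a) (atiyah_field P b) p else 0)"

text \<open>Induced by the differential of the projection; the point of the fibre chosen does not matter.\<close>

definition atiyah_anchor ::
  "'x manifold \<Rightarrow> ('p, 'x, 'k) principal \<Rightarrow> 'x \<Rightarrow> ('p \<Rightarrow> 'p tvec) \<Rightarrow> 'x tvec" where
  "atiyah_anchor M P x a =
     (let p = (SOME p. p \<in> pfib P x) in differential (ptot P) M (pproj P) p (a p))"

definition fundamental_vec ::
  "'k monoid \<Rightarrow> 'k manifold \<Rightarrow> ('p, 'x, 'k) principal \<Rightarrow> 'p \<Rightarrow> 'k tvec \<Rightarrow> 'p tvec" where
  "fundamental_vec K KM P p = differential KM (ptot P) (pact P p) \<one>\<^bsub>K\<^esub>"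

text \<open>\<open>a\<close> is the image in \<open>TP/K\<close> of the class \<open>[p, \<xi>]\<close> in \<open>ad P = P \<times>\<^sub>K \<kk>\<close>, where \<open>p\<close> lies
  over \<open>x\<close>.\<close>

definition represents_ad ::
  "'k monoid \<Rightarrow> 'k manifold \<Rightarrow> ('p, 'x, 'k) principal \<Rightarrow> 'x \<Rightarrow> ('p \<Rightarrow> 'p tvec) \<Rightarrow> 'p \<Rightarrow> 'k tvec \<Rightarrow> bool" where
  "represents_ad K KM P x a p \<xi> \<longleftrightarrow> a \<in> atiyah_fib K P x \<and> p \<in> pfib P x \<and> \<xi> \<in> lie_alg K KM \<and>
     a p = fundamental_vec K KM P p \<xi>"

definition ad_fib ::
  "'k monoid \<Rightarrow> 'k manifold \<Rightarrow> ('p, 'x, 'k) principal \<Rightarrow> 'x \<Rightarrow> ('p \<Rightarrow> 'p tvec) set" where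
  "ad_fib K KM P x = {a. \<exists>p \<xi>. represents_ad K KM P x a p \<xi>}"


section \<open>Courant and string algebroids\<close>

record ('x, 'v) courant = "('x, 'v) vbundle" +
  pairing :: "'x \<Rightarrow> 'v \<Rightarrow> 'v \<Rightarrow> real"
  anchor :: "'x \<Rightarrow> 'v \<Rightarrow> 'x tvec"
  cbracket :: "('x \<Rightarrow> 'v) \<Rightarrow> ('x \<Rightarrow> 'v) \<Rightarrow> 'x \<Rightarrow> 'v"

text \<open>\<open>\<pi>\<^sup>* : T\<^sup>*M \<rightarrow> E\<^sup>* \<cong> E\<close>\<close>

definition coanchor :: "('x, 'v) courant \<Rightarrow> 'x \<Rightarrow> ('x tvec \<Rightarrow> real) \<Rightarrow> 'v" where
  "coanchor E x \<alpha> =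
     (THE e. e \<in> fib E x \<and> (\<forall>v\<in>fib E x. pairing E x e v = \<alpha> (anchor E x v)))"

definition courant_D :: "'x manifold \<Rightarrow> ('x, 'v) courant \<Rightarrow> ('x \<Rightarrow> real) \<Rightarrow> 'x \<Rightarrow> 'v" where
  "courant_D M E f x = coanchor E x (\<lambda>w. dir_deriv M x w f)"

definition courant_algebroid :: "'x manifold \<Rightarrow> ('x, 'v::real_vector) courant \<Rightarrow> bool" where
  "courant_algebroid M E \<longleftrightarrow>
     smooth_vbundle M E \<and>
     (\<forall>x\<in>pts M. nondegenerate_form_on (fib E x) (pairing E x)) \<and>
     (\<forall>U u v. openin (mtop M) U \<and> smooth_section_on M E U u \<and> smooth_section_on M E U v \<longrightarrow>
        smooth_fun_on M U (\<lambda>x. pairing E x (u x) (v x))) \<and>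
     bundle_map M E (tangent_bundle M) (anchor E) \<and>
     (\<forall>u\<in>sections M E. \<forall>v\<in>sections M E. cbracket E u v \<in> sections M E) \<and>
     (\<forall>u\<in>sections M E. linear_map_on (sections M E) (cbracket E u) \<and>
        linear_map_on (sections M E) (\<lambda>v. cbracket E v u)) \<and>
     (\<forall>u\<in>sections M E. \<forall>v\<in>sections M E. \<forall>w\<in>sections M E. \<forall>x\<in>pts M.
        cbracket E u (cbracket E v w) x = cbracket E (cbracket E u v) w x + cbracket E v (cbracket E u w) x) \<and>
     (\<forall>u\<in>sections M E. \<forall>v\<in>sections M E. \<forall>x\<in>pts M.
        anchor E x (cbracket E u v x) =
          lie_bracket M (\<lambda>y. anchor E y (u y)) (\<lambda>y. anchor E y (v y)) x) \<and>
     (\<forall>u\<in>sections M E. \<forall>v\<in>sections M E. \<forall>f. smooth_fun_on M (pts M) f \<longrightarrow> (\<forall>x\<in>pts M.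
        cbracket E u (\<lambda>y. f y *\<^sub>R v y) x =
          dir_deriv M x (anchor E x (u x)) f *\<^sub>R v x + f x *\<^sub>R cbracket E u v x)) \<and>
     (\<forall>u\<in>sections M E. \<forall>v\<in>sections M E. \<forall>w\<in>sections M E. \<forall>x\<in>pts M.
        dir_deriv M x (anchor E x (u x)) (\<lambda>y. pairing E y (v y) (w y)) =
          pairing E x (cbracket E u v x) (w x) + pairing E x (v x) (cbracket E u w x)) \<and>
     (\<forall>u\<in>sections M E. \<forall>v\<in>sections M E. \<forall>x\<in>pts M.
        cbracket E u v x + cbracket E v u x = courant_D M E (\<lambda>y. pairing E y (u y) (v y)) x)"

definition ker_anchor :: "('x, 'v) courant \<Rightarrow> 'x \<Rightarrow> 'v set" where
  "ker_anchor E x = {e \<in> fib E x. anchor E x e = 0}"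

definition orth :: "('x, 'v) courant \<Rightarrow> 'x \<Rightarrow> 'v set \<Rightarrow> 'v set" where
  "orth E x S = {e \<in> fib E x. \<forall>s\<in>S. pairing E x e s = 0}"

definition real_string_algebroid ::
  "'x manifold \<Rightarrow> 'k monoid \<Rightarrow> 'k manifold \<Rightarrow> ('k tvec \<Rightarrow> 'k tvec \<Rightarrow> real) \<Rightarrow>
   ('x, 'v::real_vector) courant \<Rightarrow> ('p, 'x, 'k) principal \<Rightarrow> ('x \<Rightarrow> 'v \<Rightarrow> 'p \<Rightarrow> 'p tvec) \<Rightarrow> bool" where
  "real_string_algebroid M K KM B E P \<rho> \<longleftrightarrow>
     courant_algebroid M E \<and>
     principal_bundle M K KM P \<and>
     \<comment> \<open>\<open>\<rho> : E \<rightarrow> TP/K\<close> is a smooth bundle map preserving brackets\<close>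
     (\<forall>x\<in>pts M. linear_map_on (fib E x) (\<rho> x)) \<and>
     (\<forall>U u. openin (mtop M) U \<and> smooth_section_on M E U u \<longrightarrow>
        smooth_atiyah_section_on K P U (\<lambda>x. \<rho> x (u x))) \<and>
     (\<forall>u\<in>sections M E. \<forall>v\<in>sections M E. \<forall>x\<in>pts M.
        \<rho> x (cbracket E u v x) = atiyah_bracket P (\<lambda>y. \<rho> y (u y)) (\<lambda>y. \<rho> y (v y)) x) \<and>
     \<comment> \<open>exactness of \<open>0 \<rightarrow> T\<^sup>*M \<rightarrow> E \<rightarrow> TP/K \<rightarrow> 0\<close>\<close>
     (\<forall>x\<in>pts M. inj_on (coanchor E x) (cotangent_space M x) \<and>
        coanchor E x ` cotangent_space M x = {e \<in> fib E x. \<rho> x e = 0} \<and>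
        \<rho> x ` fib E x = atiyah_fib K P x) \<and>
     \<comment> \<open>the induced map \<open>E / (ker \<pi>)\<^sup>\<bottom> \<rightarrow> TP/K\<close> is well defined, injective and compatible with anchors\<close>
     (\<forall>x\<in>pts M. {e \<in> fib E x. \<rho> x e = 0} = orth E x (ker_anchor E x) \<and>
        (\<forall>e\<in>fib E x. atiyah_anchor M P x (\<rho> x e) = anchor E x e)) \<and>
     \<comment> \<open>it restricts to an isometry \<open>ker \<pi> / (ker \<pi>)\<^sup>\<bottom> \<rightarrow> ad P\<close>\<close>
     (\<forall>x\<in>pts M. \<rho> x ` ker_anchor E x = ad_fib K KM P x \<and>
        (\<forall>e\<in>ker_anchor E x. \<forall>e'\<in>ker_anchor E x. \<forall>p \<xi> \<xi>'.
           represents_ad K KM P x (\<rho> x e) p \<xi> \<and> represents_ad K KM P x (\<rho> x e') p \<xi>' \<longrightarrow>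
           pairing E x e e' = B \<xi> \<xi>'))"


section \<open>Horizontal lifts and lifts of the antiholomorphic tangent bundle\<close>

definition isotropic ::
  "'x manifold \<Rightarrow> ('x, 'v) courant \<Rightarrow> ('x \<times> ('v \<times> 'v)) set \<Rightarrow> bool" where
  "isotropic M E L \<longleftrightarrow>
     (\<forall>x\<in>pts M. \<forall>e\<in>L `` {x}. \<forall>e'\<in>L `` {x}. complexify_form (pairing E x) e e' = 0)"

definition horizontal_lift :: "'x manifold \<Rightarrow> ('x, 'v::real_vector) courant \<Rightarrow> ('x \<times> 'v) set \<Rightarrow> bool" where
  "horizontal_lift M E W \<longleftrightarrow> smooth_subbundle M E (mdim M) W \<and>
     (\<forall>x\<in>pts M. W `` {x} \<inter> ker_anchor E x = {0})"

definition lift01 :: "'x complex_mfd \<Rightarrow> ('x, 'v) courant \<Rightarrow> ('x \<times> 'v) set \<Rightarrow> ('x \<times> ('v \<times> 'v)) set" where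
  "lift01 X E W = {(x, e). x \<in> pts (underlying X) \<and> e \<in> complexify_space (W `` {x}) \<and>
     complexify_map (anchor E x) e \<in> T01 X x}"

definition isotropic_lifts ::
  "'x complex_mfd \<Rightarrow> ('x, 'v::real_vector) courant \<Rightarrow> ('x \<times> ('v \<times> 'v)) set set" where
  "isotropic_lifts X E = {L.
     (\<exists>k. smooth_complex_subbundle (underlying X) E k L) \<and> isotropic (underlying X) E L \<and>
     (\<forall>x\<in>pts (underlying X). bij_betw (complexify_map (anchor E x)) (L `` {x}) (T01 X x))}"

definition horizontal_lifts_isotropic01 ::
  "'x complex_mfd \<Rightarrow> ('x, 'v::real_vector) courant \<Rightarrow> ('x \<times> 'v) set set" where
  "horizontal_lifts_isotropic01 X E =
     {W. horizontal_lift (underlying X) E W \<and> isotropic (underlying X) E (lift01 X E W)}"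

end

theory Submission
  imports Defs "Jordan_Normal_Form.Determinant"
begin

text \<open>The elements of \<open>T\<^sup>0\<^sup>,\<^sup>1X\<close> are the pairs \<open>(v, Jv)\<close>, that is \<open>v + i Jv\<close>, with \<open>v\<close> a real tangent
  vector; here the Cauchy-Riemann equations enter, in the guise \<open>J(TX) \<subseteq> TX\<close>. Hence an element of a
  lift \<open>L\<close> of \<open>T\<^sup>0\<^sup>,\<^sup>1X\<close> is determined by its real part, and the inverse of \<open>W \<mapsto> L\<^sub>W\<close> sends \<open>L\<close> to the
  bundle of real parts of its elements; the imaginary part of \<open>e\<close> is the real part of \<open>-i e\<close>. What
  remains is smoothness. The real and imaginary parts of a frame of \<open>L\<close> form a frame of \<open>W\<close>.
  Conversely, inverting the matrix of the anchor with respect to a frame of \<open>W\<close> and a holomorphic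
  chart gives the frame \<open>s\<^sub>m\<close> of \<open>W\<close> over the coordinate fields, and the \<open>s\<^sub>2\<^sub>j + i s\<^sub>2\<^sub>j\<^sub>+\<^sub>1\<close> are a frame
  of \<open>L\<^sub>W\<close>. The ranks agree because the tangent spaces have dimension \<open>2 dim X\<close>, which is the chain
  rule for coordinate changes.\<close>

section \<open>Functions of class \<open>C\<^sup>k\<close>\<close>

lemma mem_Rn_iff: "x \<in> Rn n \<longleftrightarrow> (\<forall>i\<ge>n. x i = 0)"
  by (simp add: Rn_def topspace_Euclidean_space)

lemma openin_Euclidean_space_iff:
  "openin (Euclidean_space n) S \<longleftrightarrow> (\<exists>T. open T \<and> S = T \<inter> Rn n)"
  by (simp add: Euclidean_space_def openin_subtopology euclidean_product_topology
      mem_Rn_iff[abs_def] Rn_def)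

text \<open>A basic product neighbourhood of \<open>x\<close> bounds each coordinate separately.
  Points of \<open>Rn n\<close> agree with \<open>x\<close> from index \<open>n\<close> on, so only
  the first \<open>n\<close> radii matter, and these have a positive minimum.\<close>

lemma openin_Euclidean_space_box:
  assumes "openin (Euclidean_space n) S" and "x \<in> S"
  obtains \<epsilon> where "\<epsilon> > 0" and "\<And>y. y \<in> Rn n \<Longrightarrow> (\<And>i. i < n \<Longrightarrow> \<bar>y i - x i\<bar> < \<epsilon>) \<Longrightarrow> y \<in> S"
proof -
  obtain T where T: "open T" "S = T \<inter> Rn n"
    using assms(1) openin_Euclidean_space_iff by blast
  have "openin (product_topology (\<lambda>i. euclidean) UNIV) T" "x \<in> T"
    using T assms(2) by (simp_all add: euclidean_product_topology)
  then obtain X where X: "x \<in> Pi\<^sub>E UNIV X" "\<And>i. open (X i)" "Pi\<^sub>E UNIV X \<subseteq> T"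
    using product_topology_open_contains_basis[of "\<lambda>i. euclidean" UNIV T x] by auto
  have "\<forall>i. \<exists>e>0. ball (x i) e \<subseteq> X i"
    using X(1,2) by (metis PiE_mem UNIV_I open_contains_ball)
  then obtain e where e: "\<And>i. e i > 0" "\<And>i. ball (x i) (e i) \<subseteq> X i"
    by metis
  \<comment> \<open>The inserted 1 keeps the set nonempty when \<open>n = 0\<close>.\<close>
  define \<epsilon> where "\<epsilon> = Min (insert 1 (e ` {..<n}))"
  have pos: "\<epsilon> > 0"
    unfolding \<epsilon>_def using e(1) by (subst Min_gr_iff) auto
  have "y \<in> S" if y: "y \<in> Rn n" and c: "\<And>i. i < n \<Longrightarrow> \<bar>y i - x i\<bar> < \<epsilon>" for y
  proof -
    have "y i \<in> X i" for i
    proof (cases "i < n")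
      case True
      then have "\<epsilon> \<le> e i" unfolding \<epsilon>_def by (intro Min_le) auto
      then show ?thesis using c[OF True] e(2)[of i] by (auto simp: dist_real_def)
    next
      case False
      then have "y i = x i" using y assms(2) T(2) by (auto simp: mem_Rn_iff)
      then show ?thesis using X(1) by auto
    qed
    then show ?thesis using X(3) T(2) y by auto
  qed
  with pos show thesis using that by blast
qed

text \<open>\<open>partial\<close> restricts a function to the whole coordinate line through
  \<open>x\<close>, but a derivative sees only the points near \<open>x\<close>, and these stay in
  \<open>S\<close>. Comparing partial derivatives of functions that agree only on \<open>S\<close>
  rests on this.\<close>

lemma eventually_update_mem:
  assumes "openin (Euclidean_space n) S" and "x \<in> S" and "i < n"
  shows "eventually (\<lambda>t. x(i := t) \<in> S) (nhds (x i))"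
proof -
  obtain \<epsilon> where \<epsilon>: "\<epsilon> > 0" "\<And>y. y \<in> Rn n \<Longrightarrow> (\<And>i. i < n \<Longrightarrow> \<bar>y i - x i\<bar> < \<epsilon>) \<Longrightarrow> y \<in> S"
    using openin_Euclidean_space_box assms(1,2) by metis
  have x: "x \<in> Rn n"
    using assms(1,2) openin_Euclidean_space_iff by blast
  have "eventually (\<lambda>t. t \<in> ball (x i) \<epsilon>) (nhds (x i))"
    using \<epsilon>(1) by (intro eventually_nhds_in_open) auto
  then show ?thesis
    by eventually_elim (use x assms(3) \<epsilon> in \<open>auto intro!: \<epsilon>(2) simp: mem_Rn_iff dist_real_def\<close>)
qed

section \<open>Partial derivatives and rules of calculus\<close>

lemma Ck_on_Suc_partial:
  assumes "Ck_on (Suc k) n S f" and "x \<in> S" and "i < n"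
  shows "((\<lambda>t. f (x(i := t))) has_real_derivative partial i f x) (at (x i))"
  using assms by (simp add: partial_def DERIV_deriv_iff_real_differentiable)

text \<open>Since \<open>S\<close> is open, \<open>f\<close> and \<open>g\<close> agree on a piece
  of each coordinate line around a point of \<open>S\<close>. Their partial derivatives then agree
  on \<open>S\<close> as well, which is the hypothesis for the next order.\<close>

lemma Ck_on_cong:
  assumes "openin (Euclidean_space n) S" and "\<And>x. x \<in> S \<Longrightarrow> f x = g x" and "Ck_on k n S f"
  shows "Ck_on k n S g"
  using assms(2,3)
proof (induction k arbitrary: f g)
  case 0
  then show ?case by (simp cong: continuous_on_cong)
next
  case (Suc k)
  have ev: "eventually (\<lambda>t. f (x(i := t)) = g (x(i := t))) (nhds (x i))"
    if "x \<in> S" "i < n" for x i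
    using eventually_update_mem[OF assms(1) that] by eventually_elim (rule Suc.prems(1))
  have "partial i f x = partial i g x" if "x \<in> S" "i < n" for x i
    unfolding partial_def using ev[OF that] by (rule deriv_cong_ev) simp
  moreover have "(\<lambda>t. g (x(i := t))) differentiable (at (x i))" if "x \<in> S" "i < n" for x i
    unfolding real_differentiable_def
    using Ck_on_Suc_partial[OF Suc.prems(2) that] DERIV_cong_ev[OF refl ev[OF that] refl] by blast
  moreover have "continuous_on S g"
    using Suc.prems by (simp cong: continuous_on_cong)
  ultimately show ?case
    using Suc.prems(2) Suc.IH[of "partial i f" "partial i g" for i] by simp
qed

text \<open>Any formula \<open>D i\<close> for the derivative may stand in for
  \<open>partial i f\<close>, by \<open>Ck_on_cong\<close>. The sum, product and reciprocal rules
  enter their inductions in this way.\<close>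

lemma Ck_on_SucI:
  assumes "openin (Euclidean_space n) S" and "continuous_on S f"
    and D: "\<And>i x. i < n \<Longrightarrow> x \<in> S \<Longrightarrow> ((\<lambda>t. f (x(i := t))) has_real_derivative D i x) (at (x i))"
    and "\<And>i. i < n \<Longrightarrow> Ck_on k n S (D i)"
  shows "Ck_on (Suc k) n S f"
proof -
  have "partial i f x = D i x" if "i < n" "x \<in> S" for i x
    unfolding partial_def using D[OF that] by (rule DERIV_imp_deriv)
  then have "Ck_on k n S (partial i f)" if "i < n" for i
    using that assms(1,4) by (metis Ck_on_cong)
  then show ?thesis
    using assms(2) D by (auto simp: real_differentiable_def)
qed

lemma Ck_on_Suc_imp: "Ck_on (Suc k) n S f \<Longrightarrow> Ck_on k n S f"
  by (induction k arbitrary: f) auto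

lemma Ck_on_subset: "Ck_on k n S f \<Longrightarrow> T \<subseteq> S \<Longrightarrow> Ck_on k n T f"
  by (induction k arbitrary: f) (auto intro: continuous_on_subset)

lemma Ck_on_const: "Ck_on k n S (\<lambda>x. c)"
proof (induction k arbitrary: c)
  case (Suc k)
  have "partial i (\<lambda>x. c) = (\<lambda>x. 0)" for i by (simp add: partial_def fun_eq_iff)
  then show ?case using Suc by simp
qed simp

context
  fixes n :: nat and S :: "(nat \<Rightarrow> real) set"
  assumes S: "openin (Euclidean_space n) S"
begin

lemma Ck_on_add:
  "Ck_on k n S f \<Longrightarrow> Ck_on k n S g \<Longrightarrow> Ck_on k n S (\<lambda>x. f x + g x)"
proof (induction k arbitrary: f g)
  case (Suc k)
  have "((\<lambda>t. f (x(i := t)) + g (x(i := t))) has_real_derivative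
      partial i f x + partial i g x) (at (x i))" if "i < n" "x \<in> S" for i x
    by (rule DERIV_add[OF Ck_on_Suc_partial Ck_on_Suc_partial, OF Suc.prems(1) that(2,1) Suc.prems(2) that(2,1)])
  then show ?case
    by (rule Ck_on_SucI[OF S, rotated]) (use Suc in \<open>auto intro!: continuous_on_add\<close>)
qed (simp add: continuous_on_add)

lemma Ck_on_mult:
  "Ck_on k n S f \<Longrightarrow> Ck_on k n S g \<Longrightarrow> Ck_on k n S (\<lambda>x. f x * g x)"
proof (induction k arbitrary: f g)
  case (Suc k)
  have "((\<lambda>t. f (x(i := t)) * g (x(i := t))) has_real_derivative
      partial i f x * g x + partial i g x * f x) (at (x i))" if "i < n" "x \<in> S" for i x
    using DERIV_mult[OF Ck_on_Suc_partial Ck_on_Suc_partial, OF Suc.prems(1) that(2,1) Suc.prems(2) that(2,1)]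
    by (simp only: fun_upd_triv)
  then show ?case
    by (rule Ck_on_SucI[OF S, rotated])
      (use Suc Ck_on_Suc_imp[OF Suc.prems(1)] Ck_on_Suc_imp[OF Suc.prems(2)]
        in \<open>auto intro!: continuous_on_mult Ck_on_add\<close>)
qed (simp add: continuous_on_mult)

lemma Ck_on_minus: "Ck_on k n S f \<Longrightarrow> Ck_on k n S (\<lambda>x. - f x)"
  using Ck_on_mult[OF Ck_on_const, of k f "- 1"] by simp

text \<open>The derivative of the reciprocal is written as a product in which the reciprocal itself
  occurs, so the induction hypothesis and \<open>Ck_on_mult\<close> give its regularity.\<close>

lemma Ck_on_inverse:
  "Ck_on k n S f \<Longrightarrow> (\<And>x. x \<in> S \<Longrightarrow> f x \<noteq> 0) \<Longrightarrow> Ck_on k n S (\<lambda>x. inverse (f x))"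
proof (induction k)
  case (Suc k)
  have "((\<lambda>t. inverse (f (x(i := t)))) has_real_derivative
      - (inverse (f x) * partial i f x * inverse (f x))) (at (x i))" if "i < n" "x \<in> S" for i x
    using DERIV_inverse'[OF Ck_on_Suc_partial, OF Suc.prems(1) that(2,1)] Suc.prems(2)[OF that(2)]
    by (simp only: fun_upd_triv not_False_eq_True)
  then show ?case
    by (rule Ck_on_SucI[OF S, rotated])
      (use Suc Ck_on_Suc_imp[OF Suc.prems(1)]
        in \<open>auto intro!: continuous_on_inverse Ck_on_mult Ck_on_minus\<close>)
qed (simp add: continuous_on_inverse)

end

text \<open>By the mean value theorem along a path from \<open>g t0\<close> to \<open>g t\<close> that changes one coordinate at a
  time.\<close>

lemma chain_rule_curve:
  assumes S: "openin (Euclidean_space n) S" and F: "Ck_on (Suc 0) n S F"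
    and mem: "g t0 \<in> S" and ev: "eventually (\<lambda>t. g t \<in> Rn n) (at t0)"
    and g: "\<And>j. j < n \<Longrightarrow> ((\<lambda>t. g t j) has_real_derivative g' j) (at t0)"
  shows "((\<lambda>t. F (g t)) has_real_derivative (\<Sum>j<n. partial j F (g t0) * g' j)) (at t0)"
proof -
  \<comment> \<open>The first \<open>m\<close> coordinates have moved to those of
    \<open>g t\<close>, the others still are those of \<open>g t0\<close>. The path runs from
    \<open>y 0 t = g t0\<close> to \<open>y n t\<close>, which is \<open>g t\<close> once
    \<open>g t\<close> lies in \<open>Rn n\<close>.\<close>
  define y where "y m t = (\<lambda>i. if i < m then g t i else g t0 i)" for m t
  \<comment> \<open>The difference quotient of \<open>F\<close> over the \<open>j\<close>-th leg of
    the path. If that coordinate does not move, the value is the expected limit, so that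
    \<open>limq\<close> holds along such \<open>t\<close> too.\<close>
  define q where "q j t = (if g t j = g t0 j then partial j F (g t0)
      else (F (y (Suc j) t) - F (y j t)) / (g t j - g t0 j))" for j t
  define A where "A j t = (g t j - g t0 j) / (t - t0)" for j t
  have g0: "g t0 \<in> Rn n" using S mem openin_Euclidean_space_iff by blast
  have lim: "((\<lambda>t. g t j) \<longlongrightarrow> g t0 j) (at t0)" if "j < n" for j
    using g[OF that] DERIV_isCont isCont_def by blast
  have limq: "(q j \<longlongrightarrow> partial j F (g t0)) (at t0)" if j: "j < n" for j
  proof (rule tendstoI)
    fix e :: real assume "e > 0"
    have "continuous_on S (partial j F)" using F j by simp
    then obtain T where T: "open T" "g t0 \<in> T" 
        "\<And>z. z \<in> T \<inter> S \<Longrightarrow> dist (partial j F z) (partial j F (g t0)) < e"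
      using mem \<open>e > 0\<close> unfolding continuous_on_topological
      by (metis IntD1 IntD2 centre_in_ball mem_ball open_ball dist_commute)
    have "openin (Euclidean_space n) (T \<inter> S)"
      using S T(1) unfolding openin_Euclidean_space_iff by (metis Int_assoc open_Int)
    then obtain \<epsilon> where \<epsilon>: "\<epsilon> > 0" 
      "\<And>z. z \<in> Rn n \<Longrightarrow> (\<And>i. i < n \<Longrightarrow> \<bar>z i - g t0 i\<bar> < \<epsilon>) \<Longrightarrow> z \<in> T \<inter> S"
      using openin_Euclidean_space_box mem T(2) by (metis IntI)
    have "eventually (\<lambda>t. \<forall>i\<in>{..<n}. dist (g t i) (g t0 i) < \<epsilon>) (at t0)"
      using lim \<epsilon>(1) by (intro eventually_ball_finite) (auto intro: tendstoD)
    then show "eventually (\<lambda>t. dist (q j t) (partial j F (g t0)) < e) (at t0)"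
      using ev
    proof eventually_elim
      case (elim t)
      show ?case
      proof (cases "g t j = g t0 j")
        case True
        then show ?thesis using \<open>e > 0\<close> by (simp add: q_def)
      next
        case False
        have seg: "(y j t)(j := s) \<in> T \<inter> S" if "\<bar>s - g t0 j\<bar> < \<epsilon>" for s
          by (rule \<epsilon>(2)) (use elim that \<epsilon>(1) g0 j in \<open>auto simp: y_def mem_Rn_iff dist_real_def\<close>)
        have der: "((\<lambda>s. F ((y j t)(j := s))) has_real_derivative partial j F ((y j t)(j := s))) (at s)"
          if "\<bar>s - g t0 j\<bar> < \<epsilon>" for s
          using Ck_on_Suc_partial[OF F, of "(y j t)(j := s)" j] seg[OF that] j by simp
        have y0: "(y j t)(j := g t0 j) = y j t" and y1: "(y j t)(j := g t j) = y (Suc j) t"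
          by (auto simp: y_def fun_eq_iff)
        have b: "\<bar>g t j - g t0 j\<bar> < \<epsilon>" using elim j by (auto simp: dist_real_def)
        \<comment> \<open>\<open>MVT2\<close> takes its endpoints in increasing order, hence two
          cases.\<close>
        have "\<exists>s. \<bar>s - g t0 j\<bar> < \<epsilon> \<and> F (y (Suc j) t) - F (y j t)
            = (g t j - g t0 j) * partial j F ((y j t)(j := s))"
        proof (cases "g t0 j < g t j")
          case True
          have "\<exists>s>g t0 j. s < g t j \<and> F ((y j t)(j := g t j)) - F ((y j t)(j := g t0 j))
            = (g t j - g t0 j) * partial j F ((y j t)(j := s))"
            using True b by (intro MVT2 der) auto
          then obtain s where "g t0 j < s" "s < g t j" "F ((y j t)(j := g t j)) - F ((y j t)(j := g t0 j))
            = (g t j - g t0 j) * partial j F ((y j t)(j := s))" by auto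
          then show ?thesis using b unfolding y0 y1 by (intro exI[of _ s]) auto
        next
          case False2: False
          have "\<exists>s>g t j. s < g t0 j \<and> F ((y j t)(j := g t0 j)) - F ((y j t)(j := g t j))
            = (g t0 j - g t j) * partial j F ((y j t)(j := s))"
            using False False2 b by (intro MVT2 der) auto
          then obtain s where "g t j < s" "s < g t0 j" "F ((y j t)(j := g t0 j)) - F ((y j t)(j := g t j))
            = (g t0 j - g t j) * partial j F ((y j t)(j := s))" by auto
          then show ?thesis using b unfolding y0 y1 by (intro exI[of _ s]) (auto simp: algebra_simps)
        qed
        then obtain s where s: "\<bar>s - g t0 j\<bar> < \<epsilon>" "F (y (Suc j) t) - F (y j t)
            = (g t j - g t0 j) * partial j F ((y j t)(j := s))" by blast
        then have "q j t = partial j F ((y j t)(j := s))"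
          using False by (simp add: q_def)
        then show ?thesis using T(3) seg[OF s(1)] by simp
      qed
    qed
  qed
  \<comment> \<open>A leg contributes its quotient \<open>q\<close> times the average speed
    \<open>A\<close> of its coordinate. The legs telescope to the difference quotient of
    \<open>F\<close> along \<open>g\<close>.\<close>
  have "((\<lambda>t. \<Sum>j<n. q j t * A j t) \<longlongrightarrow> (\<Sum>j<n. partial j F (g t0) * g' j)) (at t0)"
    unfolding A_def using g limq by (intro tendsto_sum tendsto_mult) (auto simp: has_field_derivative_iff)
  moreover have "eventually (\<lambda>t. (\<Sum>j<n. q j t * A j t) = (F (g t) - F (g t0)) / (t - t0)) (at t0)"
    using ev
  proof eventually_elim
    case (elim t)
    have q: "q j t * A j t = (F (y (Suc j) t) - F (y j t)) / (t - t0)" for j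
    proof (cases "g t j = g t0 j")
      case True
      then have "y (Suc j) t = y j t" by (auto simp: y_def fun_eq_iff less_Suc_eq)
      then show ?thesis using True by (simp add: A_def)
    qed (simp add: q_def A_def)
    have "y n t = g t" "y 0 t = g t0"
      using elim g0 by (auto simp: y_def fun_eq_iff mem_Rn_iff)
    then show ?case
      unfolding q using sum_lessThan_telescope[of "\<lambda>j. F (y j t)" n]
      by (simp flip: sum_divide_distrib)
  qed
  ultimately show ?thesis
    unfolding has_field_derivative_iff by (rule Lim_transform_eventually)
qed

section \<open>Linear algebra with indexed families\<close>

context vector_space
begin

text \<open>Stated for general scalars so that real frames and, through \<open>cvec\<close>, complex
  frames share it. The coefficients sit on the indices because a family may repeat vectors.\<close>

lemma span_indexed:
  assumes "finite I"
  shows "span (w ` I) = range (\<lambda>a. \<Sum>i\<in>I. a i *s w i)"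
proof (rule subset_antisym)
  have "w j = (\<Sum>i\<in>I. (if i = j then 1 else 0) *s w i)" if "j \<in> I" for j
  proof -
    have "(\<Sum>i\<in>I. (if i = j then 1 else 0) *s w i) = (\<Sum>i\<in>I. if i = j then w i else 0)"
      by (intro sum.cong) auto
    then show ?thesis using assms that by simp
  qed
  then have "w ` I \<subseteq> range (\<lambda>a. \<Sum>i\<in>I. a i *s w i)"
    by (intro image_subsetI range_eqI)
  moreover have "subspace (range (\<lambda>a. \<Sum>i\<in>I. a i *s w i))"
  proof (rule subspaceI)
    show "0 \<in> range (\<lambda>a. \<Sum>i\<in>I. a i *s w i)"
      by (rule image_eqI[of _ _ "\<lambda>_. 0"]) auto
  next
    fix x y assume "x \<in> range (\<lambda>a. \<Sum>i\<in>I. a i *s w i)" "y \<in> range (\<lambda>a. \<Sum>i\<in>I. a i *s w i)"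
    then obtain a b where "x = (\<Sum>i\<in>I. a i *s w i)" "y = (\<Sum>i\<in>I. b i *s w i)" by auto
    then show "x + y \<in> range (\<lambda>a. \<Sum>i\<in>I. a i *s w i)"
      by (intro image_eqI[of _ _ "\<lambda>i. a i + b i"]) (auto simp: scale_left_distrib sum.distrib)
  next
    fix c x assume "x \<in> range (\<lambda>a. \<Sum>i\<in>I. a i *s w i)"
    then obtain a where "x = (\<Sum>i\<in>I. a i *s w i)" by auto
    then show "c *s x \<in> range (\<lambda>a. \<Sum>i\<in>I. a i *s w i)"
      by (intro image_eqI[of _ _ "\<lambda>i. c * a i"]) (auto simp: scale_sum_right)
  qed
  ultimately show "span (w ` I) \<subseteq> range (\<lambda>a. \<Sum>i\<in>I. a i *s w i)"
    by (rule span_minimal)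
next
  show "range (\<lambda>a. \<Sum>i\<in>I. a i *s w i) \<subseteq> span (w ` I)"
    by (intro image_subsetI span_sum span_scale span_base imageI)
qed

text \<open>\<open>independent\<close> speaks of a set and does not see repetitions in a family.
  Together with injectivity it becomes the usual condition on coefficients, the form in which frames
  are handled below.\<close>

lemma independent_indexed_iff:
  assumes "finite I"
  shows "inj_on w I \<and> independent (w ` I) \<longleftrightarrow>
    (\<forall>a. (\<Sum>i\<in>I. a i *s w i) = 0 \<longrightarrow> (\<forall>i\<in>I. a i = 0))"
proof safe
  fix a i
  assume inj: "inj_on w I" and ind: "independent (w ` I)"
    and s: "(\<Sum>i\<in>I. a i *s w i) = 0" and i: "i \<in> I"
  have "(\<Sum>v\<in>w ` I. a (inv_into I w v) *s v) = 0"
    using s inj by (simp add: sum.reindex)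
  then have "a (inv_into I w (w i)) = 0"
    using ind i assms by (intro independentD[of "w ` I" "w ` I" "\<lambda>v. a (inv_into I w v)" "w i"]) auto
  then show "a i = 0" using inj i by simp
next
  assume *: "\<forall>a. (\<Sum>i\<in>I. a i *s w i) = 0 \<longrightarrow> (\<forall>i\<in>I. a i = 0)"
  show inj: "inj_on w I"
  proof (rule inj_onI, rule ccontr)
    fix i j assume ij: "i \<in> I" "j \<in> I" "w i = w j" "i \<noteq> j"
    \<comment> \<open>Two equal members of the family cancel each other, which is a nontrivial
      relation.\<close>
    define a where "a k = (if k = i then 1 :: 'a else if k = j then - 1 else 0)" for k
    have "(\<Sum>k\<in>I. a k *s w k) = (\<Sum>k\<in>I. (if k = i then w i else 0) - (if k = j then w i else 0))"
      using ij by (intro sum.cong) (auto simp: a_def)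
    also have "\<dots> = 0" using ij assms by (simp add: sum_subtractf)
    finally have "a i = 0" using * ij(1) by blast
    then show False by (simp add: a_def)
  qed
  show "dependent (w ` I) \<Longrightarrow> False"
  proof -
    have "independent (w ` I)"
    proof (rule independent_if_scalars_zero)
      fix f x assume s: "(\<Sum>x\<in>w ` I. f x *s x) = 0" and "x \<in> w ` I"
      then obtain i where i: "i \<in> I" "x = w i" by auto
      have "(\<Sum>i\<in>I. f (w i) *s w i) = 0" using s inj by (simp add: sum.reindex)
      then have "f (w i) = 0" by (rule *[rule_format, of "\<lambda>i. f (w i)"]) (rule i(1))
      then show "f x = 0" using i by simp
    qed (use assms in auto)
    then show "dependent (w ` I) \<Longrightarrow> False" by simp
  qed
qed

end

section \<open>Smooth functions and tangent spaces\<close>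

lemma chart_inj:
  assumes "smooth_manifold M" and "(V, \<phi>) \<in> atlas M"
  shows "inj_on \<phi> V"
proof -
  have "is_chart (mtop M) (mdim M) (V, \<phi>)" using assms by (auto simp: smooth_manifold_def)
  then have "V \<subseteq> topspace (mtop M)"
      "homeomorphic_map (subtopology (mtop M) V) (subtopology (Euclidean_space (mdim M)) (\<phi> ` V)) \<phi>"
    by (auto simp: is_chart_def openin_subset)
  then show ?thesis
    using homeomorphic_imp_injective_map by (metis inf_absorb2 topspace_subtopology)
qed

lemma openin_chart_image:
  assumes "smooth_manifold M" and "(V, \<phi>) \<in> atlas M" and "openin (mtop M) U"
  shows "openin (Euclidean_space (mdim M)) (\<phi> ` (U \<inter> V))"
proof -
  have "is_chart (mtop M) (mdim M) (V, \<phi>)" using assms by (auto simp: smooth_manifold_def)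
  then have V: "openin (mtop M) V" "openin (Euclidean_space (mdim M)) (\<phi> ` V)"
      "homeomorphic_map (subtopology (mtop M) V) (subtopology (Euclidean_space (mdim M)) (\<phi> ` V)) \<phi>"
    by (auto simp: is_chart_def)
  have "openin (subtopology (mtop M) V) (U \<inter> V)"
    using assms(3) by (auto simp: openin_subtopology)
  then have "openin (subtopology (Euclidean_space (mdim M)) (\<phi> ` V)) (\<phi> ` (U \<inter> V))"
    using homeomorphic_imp_open_map[OF V(3)] open_map_def by blast
  then show ?thesis using V(2) openin_open_subtopology by blast
qed

lemma openin_chart_domain:
  "smooth_manifold M \<Longrightarrow> (V, \<phi>) \<in> atlas M \<Longrightarrow> openin (mtop M) V"
  by (auto simp: smooth_manifold_def is_chart_def)

lemma chart_image_subset_Rn: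
  assumes "smooth_manifold M" and "(V, \<phi>) \<in> atlas M"
  shows "\<phi> ` V \<subseteq> Rn (mdim M)"
  using openin_chart_image[OF assms openin_chart_domain[OF assms]] openin_Euclidean_space_iff by auto

lemma smooth_fun_on_subset: "smooth_fun_on M U f \<Longrightarrow> T \<subseteq> U \<Longrightarrow> smooth_fun_on M T f"
  unfolding smooth_fun_on_def Cinf_on_def by (fast intro: Ck_on_subset)

lemma smooth_fun_on_const: "smooth_fun_on M U (\<lambda>_. c)"
  by (auto simp: smooth_fun_on_def Cinf_on_def Ck_on_const)

context
  fixes M :: "'a manifold" and U :: "'a set"
  assumes M: "smooth_manifold M" and U: "openin (mtop M) U"
begin

lemma smooth_fun_on_cong:
  assumes "\<And>x. x \<in> U \<Longrightarrow> f x = g x" and "smooth_fun_on M U f"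
  shows "smooth_fun_on M U g"
  unfolding smooth_fun_on_def Cinf_on_def
proof clarify
  fix V \<phi> k assume V: "(V, \<phi>) \<in> atlas M"
  have "f (inv_into V \<phi> y) = g (inv_into V \<phi> y)" if "y \<in> \<phi> ` (U \<inter> V)" for y
    using that assms(1) chart_inj[OF M V] by auto
  moreover have "Ck_on k (mdim M) (\<phi> ` (U \<inter> V)) (\<lambda>y. f (inv_into V \<phi> y))"
    using assms(2) V by (auto simp: smooth_fun_on_def Cinf_on_def)
  ultimately show "Ck_on k (mdim M) (\<phi> ` (U \<inter> V)) (\<lambda>y. g (inv_into V \<phi> y))"
    by (rule Ck_on_cong[OF openin_chart_image[OF M V U]])
qed

lemma smooth_fun_on_add:
  "smooth_fun_on M U f \<Longrightarrow> smooth_fun_on M U g \<Longrightarrow> smooth_fun_on M U (\<lambda>x. f x + g x)"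
  unfolding smooth_fun_on_def Cinf_on_def
  by clarify (fast intro: Ck_on_add[OF openin_chart_image[OF M _ U]])

lemma smooth_fun_on_mult:
  "smooth_fun_on M U f \<Longrightarrow> smooth_fun_on M U g \<Longrightarrow> smooth_fun_on M U (\<lambda>x. f x * g x)"
  unfolding smooth_fun_on_def Cinf_on_def
  by clarify (fast intro: Ck_on_mult[OF openin_chart_image[OF M _ U]])

lemma smooth_fun_on_inverse:
  assumes "smooth_fun_on M U f" and nz: "\<And>x. x \<in> U \<Longrightarrow> f x \<noteq> 0"
  shows "smooth_fun_on M U (\<lambda>x. inverse (f x))"
  unfolding smooth_fun_on_def Cinf_on_def
proof clarify
  fix V \<phi> k assume V: "(V, \<phi>) \<in> atlas M"
  have "f (inv_into V \<phi> y) \<noteq> 0" if "y \<in> \<phi> ` (U \<inter> V)" for y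
    using that nz chart_inj[OF M V] by auto
  moreover have "Ck_on k (mdim M) (\<phi> ` (U \<inter> V)) (\<lambda>y. f (inv_into V \<phi> y))"
    using assms(1) V by (auto simp: smooth_fun_on_def Cinf_on_def)
  ultimately show "Ck_on k (mdim M) (\<phi> ` (U \<inter> V)) (\<lambda>y. inverse (f (inv_into V \<phi> y)))"
    by (intro Ck_on_inverse[OF openin_chart_image[OF M V U]])
qed

lemma smooth_fun_on_sum:
  "(\<And>i. i \<in> I \<Longrightarrow> smooth_fun_on M U (f i)) \<Longrightarrow> smooth_fun_on M U (\<lambda>x. \<Sum>i\<in>I. f i x)"
  by (induction I rule: infinite_finite_induct) (auto intro: smooth_fun_on_const smooth_fun_on_add)

lemma smooth_fun_on_prod:
  "(\<And>i. i \<in> I \<Longrightarrow> smooth_fun_on M U (f i)) \<Longrightarrow> smooth_fun_on M U (\<lambda>x. \<Prod>i\<in>I. f i x)"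
  by (induction I rule: infinite_finite_induct) (auto intro: smooth_fun_on_const smooth_fun_on_mult)

section \<open>Matrices with smooth entries\<close>

lemma smooth_fun_on_det:
  assumes "\<And>i j. i < m \<Longrightarrow> j < m \<Longrightarrow> smooth_fun_on M U (a i j)"
  shows "smooth_fun_on M U (\<lambda>x. Determinant.det (Matrix.mat m m (\<lambda>(i, j). a i j x)))"
proof -
  have "smooth_fun_on M U (\<lambda>x. \<Sum>p | p permutes {0..<m}. of_int (sign p) * (\<Prod>i = 0..<m. a i (p i) x))"
    by (intro smooth_fun_on_sum smooth_fun_on_mult smooth_fun_on_const smooth_fun_on_prod assms)
      (auto simp: permutes_in_image)
  moreover have "(\<Sum>p | p permutes {0..<m}. of_int (sign p) * (\<Prod>i = 0..<m. a i (p i) x)) =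
      Determinant.det (Matrix.mat m m (\<lambda>(i, j). a i j x))" for x
    by (subst det_def'[where n = m]) (auto intro!: sum.cong prod.cong simp: permutes_in_image)
  ultimately show ?thesis by simp
qed

text \<open>Cramer's rule: trivial kernel makes the determinant nonzero, and the inverse is the
  adjugate divided by it. The entries of the adjugate are signed minors, hence smooth.\<close>

lemma smooth_matrix_right_inverse:
  fixes m :: nat
  assumes smooth: "\<And>i j. i < m \<Longrightarrow> j < m \<Longrightarrow> smooth_fun_on M U (a i j)"
    and inj: "\<And>x c. x \<in> U \<Longrightarrow> (\<And>i. i < m \<Longrightarrow> (\<Sum>j<m. a i j x * c j) = 0) \<Longrightarrow> \<forall>j<m. c j = 0"
  obtains b where "\<And>i j. i < m \<Longrightarrow> j < m \<Longrightarrow> smooth_fun_on M U (b i j)"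
    and "\<And>x i j. x \<in> U \<Longrightarrow> i < m \<Longrightarrow> j < m \<Longrightarrow> (\<Sum>k<m. a i k x * b k j x) = (if i = j then 1 else 0)"
proof -
  define A where "A x = Matrix.mat m m (\<lambda>(i, j). a i j x)" for x
  have A: "A x \<in> carrier_mat m m" for x by (simp add: A_def)
  have nz: "Determinant.det (A x) \<noteq> 0" if x: "x \<in> U" for x
  proof
    assume "Determinant.det (A x) = 0"
    then obtain v where v: "v \<in> carrier_vec m" "v \<noteq> 0\<^sub>v m" "A x *\<^sub>v v = 0\<^sub>v m"
      using det_0_iff_vec_prod_zero[OF A] by blast
    have "(\<Sum>j<m. a i j x * vec_index v j) = 0" if "i < m" for i
    proof -
      have "vec_index (A x *\<^sub>v v) i = (\<Sum>j<m. a i j x * vec_index v j)"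
        using that v(1) by (simp add: A_def scalar_prod_def atLeast0LessThan)
      then show ?thesis using v(3) that by simp
    qed
    then have "\<forall>j<m. vec_index v j = 0" using inj[OF x, of "vec_index v"] by blast
    then have "v = 0\<^sub>v m" using v(1) by (intro eq_vecI) auto
    then show False using v(2) by simp
  qed
  define b where "b i j x = inverse (Determinant.det (A x)) * (adj_mat (A x) $$ (i, j))" for i j x
  have "smooth_fun_on M U (b i j)" if "i < m" "j < m" for i j
  proof -
    \<comment> \<open>The adjugate is the transposed cofactor matrix, so row \<open>j\<close> and
      column \<open>i\<close> are the ones deleted. The case distinctions skip these two
      indices.\<close>
    have "adj_mat (A x) $$ (i, j) = (- 1) ^ (j + i) * Determinant.det (Matrix.mat (m - 1) (m - 1)
        (\<lambda>(i', j'). a (if i' < j then i' else Suc i') (if j' < i then j' else Suc j') x))" for x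
      unfolding adj_mat_def cofactor_def mat_delete_def using that
      by (auto simp: A_def intro!: arg_cong[where f = Determinant.det] eq_matI)
    then show ?thesis
      unfolding b_def using that
      by (auto simp: A_def intro!: smooth_fun_on_mult smooth_fun_on_const
          smooth_fun_on_inverse smooth_fun_on_det smooth nz[unfolded A_def])
  qed
  moreover have "(\<Sum>k<m. a i k x * b k j x) = (if i = j then 1 else 0)"
    if "x \<in> U" "i < m" "j < m" for x i j
  proof -
    have "(\<Sum>k<m. a i k x * b k j x) = inverse (Determinant.det (A x)) * ((A x * adj_mat (A x)) $$ (i, j))"
      using that adj_mat(1)[OF A[of x]]
      by (simp add: A_def b_def scalar_prod_def atLeast0LessThan sum_distrib_left mult_ac)
    then show ?thesis
      using nz[OF that(1)] that by (simp add: adj_mat(2)[OF A])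
  qed
  ultimately show thesis using that by blast
qed

end

section \<open>Jacobians of coordinate changes\<close>

lemma smooth_transition:
  assumes "smooth_manifold M" and "(U, \<phi>) \<in> atlas M" and "(V, \<psi>) \<in> atlas M" and "j < mdim M"
  shows "Cinf_on (mdim M) (\<phi> ` (U \<inter> V)) (\<lambda>y. \<psi> (inv_into U \<phi> y) j)"
proof -
  have "\<forall>(U, \<phi>)\<in>atlas M. \<forall>(V, \<psi>)\<in>atlas M. \<forall>j<mdim M.
      Cinf_on (mdim M) (\<phi> ` (U \<inter> V)) (\<lambda>y. \<psi> (inv_into U \<phi> y) j)"
    using assms(1) unfolding smooth_manifold_def by (elim conjE)
  from bspec[OF bspec[OF this assms(2), simplified] assms(3)] assms(4) show ?thesis by simp
qed

text \<open>The \<open>i\<close>-th coordinate line of \<phi>, seen through \<psi>, is a curve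
  \<open>g\<close>. Near \<open>p\<close> it stays in the overlap with the third chart, where
  \<theta> along the line equals the transition from \<psi> to \<theta> evaluated on
  \<open>g\<close>; hence \<open>chain_rule_curve\<close> applies.\<close>

lemma chart_transition_chain_rule:
  assumes M: "smooth_manifold M"
    and charts: "(U, \<phi>) \<in> atlas M" "(V, \<psi>) \<in> atlas M" "(W, \<theta>) \<in> atlas M"
    and p: "p \<in> U" "p \<in> V" "p \<in> W" and ij: "i < mdim M" "j < mdim M"
  shows "partial i (\<lambda>y. \<theta> (inv_into U \<phi> y) j) (\<phi> p) =
    (\<Sum>l<mdim M. partial l (\<lambda>y. \<theta> (inv_into V \<psi> y) j) (\<psi> p) *
      partial i (\<lambda>y. \<psi> (inv_into U \<phi> y) l) (\<phi> p))"
proof -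
  define g where "g t = \<psi> (inv_into U \<phi> ((\<phi> p)(i := t)))" for t
  note dom = openin_chart_domain[OF M]
  have inj: "inj_on \<phi> U" "inj_on \<psi> V" using chart_inj[OF M] charts by auto
  have Ck: "Ck_on (Suc 0) (mdim M) (\<alpha> ` (A \<inter> B)) (\<lambda>y. \<beta> (inv_into A \<alpha> y) l)"
    if "(A, \<alpha>) \<in> atlas M" "(B, \<beta>) \<in> atlas M" "l < mdim M" for A B \<alpha> \<beta> l
    using smooth_transition[OF M that] by (simp only: Cinf_on_def)
  have g0: "g (\<phi> p i) = \<psi> p" using inj p by (simp add: g_def)
  have "openin (mtop M) (V \<inter> W)" using dom charts by (blast intro: openin_Int)
  then have "eventually (\<lambda>t. (\<phi> p)(i := t) \<in> \<phi> ` ((V \<inter> W) \<inter> U)) (nhds (\<phi> p i))"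
    using p ij by (intro eventually_update_mem[OF openin_chart_image[OF M charts(1)]]) auto
  then have ev: "eventually (\<lambda>t. g t \<in> Rn (mdim M) \<and>
      \<theta> (inv_into V \<psi> (g t)) = \<theta> (inv_into U \<phi> ((\<phi> p)(i := t)))) (nhds (\<phi> p i))"
  proof eventually_elim
    case (elim t)
    then obtain q where q: "q \<in> U" "q \<in> V" "q \<in> W" "(\<phi> p)(i := t) = \<phi> q" by auto
    then show ?case
      using inj chart_image_subset_Rn[OF M charts(2)] by (auto simp: g_def)
  qed
  have "((\<lambda>t. \<theta> (inv_into V \<psi> (g t)) j) has_real_derivative
      (\<Sum>l<mdim M. partial l (\<lambda>y. \<theta> (inv_into V \<psi> y) j) (g (\<phi> p i)) *
        partial i (\<lambda>y. \<psi> (inv_into U \<phi> y) l) (\<phi> p))) (at (\<phi> p i))"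
  proof (rule chain_rule_curve)
    show "openin (Euclidean_space (mdim M)) (\<psi> ` (V \<inter> W))"
      using openin_chart_image[OF M charts(2) dom[OF charts(3)]] by (simp add: Int_commute)
    show "Ck_on (Suc 0) (mdim M) (\<psi> ` (V \<inter> W)) (\<lambda>y. \<theta> (inv_into V \<psi> y) j)"
      using Ck charts ij by blast
    show "g (\<phi> p i) \<in> \<psi> ` (V \<inter> W)" using p g0 by auto
    show "eventually (\<lambda>t. g t \<in> Rn (mdim M)) (at (\<phi> p i))"
      using ev by (auto simp: eventually_at_filter elim: eventually_mono)
    show "((\<lambda>t. g t l) has_real_derivative partial i (\<lambda>y. \<psi> (inv_into U \<phi> y) l) (\<phi> p)) (at (\<phi> p i))"
      if "l < mdim M" for l
      unfolding g_def by (rule Ck_on_Suc_partial[OF Ck[OF charts(1,2) that]]) (use p ij in auto)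
  qed
  then have "((\<lambda>t. \<theta> (inv_into U \<phi> ((\<phi> p)(i := t))) j) has_real_derivative
      (\<Sum>l<mdim M. partial l (\<lambda>y. \<theta> (inv_into V \<psi> y) j) (\<psi> p) *
        partial i (\<lambda>y. \<psi> (inv_into U \<phi> y) l) (\<phi> p))) (at (\<phi> p i))"
    unfolding g0 by (subst (asm) DERIV_cong_ev[OF refl _ refl]) (use ev in \<open>auto elim: eventually_mono\<close>)
  then show ?thesis unfolding partial_def by (rule DERIV_imp_deriv)
qed

lemma partial_chart_self:
  assumes M: "smooth_manifold M" and c: "(U, \<phi>) \<in> atlas M" and p: "p \<in> U" and i: "i < mdim M"
  shows "partial i (\<lambda>y. \<phi> (inv_into U \<phi> y) j) (\<phi> p) = (if i = j then 1 else 0)"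
proof -
  have "eventually (\<lambda>t. (\<phi> p)(i := t) \<in> \<phi> ` (U \<inter> U)) (nhds (\<phi> p i))"
    using p i by (intro eventually_update_mem[OF openin_chart_image[OF M c openin_chart_domain[OF M c]]]) auto
  then have ev: "eventually (\<lambda>t. \<phi> (inv_into U \<phi> ((\<phi> p)(i := t))) j = ((\<phi> p)(i := t)) j) (nhds (\<phi> p i))"
  proof eventually_elim
    case (elim t)
    then have "\<phi> (inv_into U \<phi> ((\<phi> p)(i := t))) = (\<phi> p)(i := t)" by (simp only: f_inv_into_f Int_absorb)
    then show ?case by (rule fun_cong)
  qed
  have "partial i (\<lambda>y. \<phi> (inv_into U \<phi> y) j) (\<phi> p) = deriv (\<lambda>t. ((\<phi> p)(i := t)) j) (\<phi> p i)"
    unfolding partial_def using ev by (rule deriv_cong_ev) simp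
  also have "\<dots> = (if i = j then 1 else 0)" by (cases "i = j") (simp_all add: fun_upd_def)
  finally show ?thesis .
qed

text \<open>The Jacobian matrix of the coordinate change from \<open>c\<close> to \<open>d\<close>,
  with the row index before the column index, so that the transformation law of tangent vectors is a
  matrix times a vector.\<close>

definition chart_jacobian :: "'a chart \<Rightarrow> 'a chart \<Rightarrow> 'a \<Rightarrow> nat \<Rightarrow> nat \<Rightarrow> real" where
  "chart_jacobian c d p j i = partial i (\<lambda>y. snd d (inv_into (fst c) (snd c) y) j) (snd c p)"

section \<open>Tangent vectors in charts\<close>

lemma tangent_space_iff:
  "v \<in> tangent_space M p \<longleftrightarrow>
     (\<forall>c. v c \<in> Rn (mdim M)) \<and> (\<forall>c. c \<notin> atlas M \<or> p \<notin> fst c \<longrightarrow> v c = 0) \<and>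
     (\<forall>c\<in>atlas M. \<forall>d\<in>atlas M. p \<in> fst c \<and> p \<in> fst d \<longrightarrow>
        (\<forall>j<mdim M. v d j = (\<Sum>i<mdim M. chart_jacobian c d p j i * v c i)))"
  by (simp add: tangent_space_def chart_jacobian_def split_paired_Ball_Sigma split_beta)

lemma tangent_space_Rn: "v \<in> tangent_space M p \<Longrightarrow> v c \<in> Rn (mdim M)"
  unfolding tangent_space_iff by blast

lemma tangent_space_off_chart: "v \<in> tangent_space M p \<Longrightarrow> c \<notin> atlas M \<or> p \<notin> fst c \<Longrightarrow> v c = 0"
  unfolding tangent_space_iff by blast

lemma tangent_space_jacobian:
  assumes "v \<in> tangent_space M p" and "c \<in> atlas M" "d \<in> atlas M" "p \<in> fst c" "p \<in> fst d" "j < mdim M"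
  shows "v d j = (\<Sum>i<mdim M. chart_jacobian c d p j i * v c i)"
  using assms unfolding tangent_space_iff by blast

lemma subspace_tangent_space: "subspace (tangent_space M p)"
proof (rule subspaceI)
  show "0 \<in> tangent_space M p"
    by (simp add: tangent_space_iff mem_Rn_iff)
next
  fix u v assume uv: "u \<in> tangent_space M p" "v \<in> tangent_space M p"
  have "(u + v) d j = (\<Sum>i<mdim M. chart_jacobian c d p j i * (u + v) c i)"
    if "c \<in> atlas M" "d \<in> atlas M" "p \<in> fst c" "p \<in> fst d" "j < mdim M" for c d j
    by (simp add: tangent_space_jacobian[OF uv(1) that] tangent_space_jacobian[OF uv(2) that]
        distrib_left sum.distrib del: sum.cong)
  moreover have "(u + v) c \<in> Rn (mdim M)" for c
    using uv[THEN tangent_space_Rn, of c] by (simp add: mem_Rn_iff)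
  moreover have "c \<notin> atlas M \<or> p \<notin> fst c \<longrightarrow> (u + v) c = 0" for c
    using uv[THEN tangent_space_off_chart, of c] by auto
  ultimately show "u + v \<in> tangent_space M p"
    unfolding tangent_space_iff by blast
next
  fix r u assume u: "u \<in> tangent_space M p"
  have "(r *\<^sub>R u) d j = (\<Sum>i<mdim M. chart_jacobian c d p j i * (r *\<^sub>R u) c i)"
    if "c \<in> atlas M" "d \<in> atlas M" "p \<in> fst c" "p \<in> fst d" "j < mdim M" for c d j
    using tangent_space_jacobian[OF u that]
    by (simp add: scaleR_fun_def sum_distrib_left mult.left_commute)
  moreover have "(r *\<^sub>R u) c \<in> Rn (mdim M)" for c
    using tangent_space_Rn[OF u, of c] by (simp add: mem_Rn_iff scaleR_fun_def)
  moreover have "c \<notin> atlas M \<or> p \<notin> fst c \<longrightarrow> (r *\<^sub>R u) c = 0" for c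
    using tangent_space_off_chart[OF u, of c] by (auto simp: scaleR_fun_def)
  ultimately show "r *\<^sub>R u \<in> tangent_space M p"
    unfolding tangent_space_iff by blast
qed

text \<open>The Jacobians carry the components in one chart around \<open>p\<close> to every other
  such chart, and all remaining entries are 0.\<close>

lemma tangent_space_chart_inj:
  assumes u: "u \<in> tangent_space M p" and v: "v \<in> tangent_space M p"
    and c: "c \<in> atlas M" "p \<in> fst c" and eq: "u c = v c"
  shows "u = v"
proof (rule ext)+
  fix d j
  show "u d j = v d j"
  proof (cases "d \<in> atlas M \<and> p \<in> fst d \<and> j < mdim M")
    case True
    then have d: "d \<in> atlas M" "p \<in> fst d" "j < mdim M" by auto
    show ?thesis
      unfolding tangent_space_jacobian[OF u c(1) d(1) c(2) d(2,3)]
        tangent_space_jacobian[OF v c(1) d(1) c(2) d(2,3)] eq ..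
  next
    case False
    then have "w d j = 0" if "w \<in> tangent_space M p" for w
      using tangent_space_Rn[OF that, of d] tangent_space_off_chart[OF that, of d]
      by (auto simp: mem_Rn_iff)
    from this[OF u] this[OF v] show ?thesis by simp
  qed
qed

text \<open>The components \<open>y\<close> in the chart \<open>c\<close> are spread to the other
  charts by the Jacobians out of \<open>c\<close>. Compatibility between two further charts is the
  chain rule, and the Jacobian from \<open>c\<close> to itself is the identity.\<close>

lemma tangent_space_chart_surj:
  assumes M: "smooth_manifold M" and c: "c \<in> atlas M" "p \<in> fst c" and y: "y \<in> Rn (mdim M)"
  obtains v where "v \<in> tangent_space M p" and "v c = y"
proof -
  define v where "v d = (\<lambda>j. if d \<in> atlas M \<and> p \<in> fst d \<and> j < mdim M
    then \<Sum>i<mdim M. chart_jacobian c d p j i * y i else 0)" for d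
  have "v d j = (\<Sum>l<mdim M. chart_jacobian e d p j l * v e l)"
    if d: "d \<in> atlas M" "p \<in> fst d" and e: "e \<in> atlas M" "p \<in> fst e" and j: "j < mdim M" for d e j
  proof -
    have "v d j = (\<Sum>i<mdim M. (\<Sum>l<mdim M. chart_jacobian e d p j l * chart_jacobian c e p l i) * y i)"
      using d j chart_transition_chain_rule[OF M, of "fst c" "snd c" "fst e" "snd e" "fst d" "snd d" p] c e
      by (simp add: v_def chart_jacobian_def)
    also have "\<dots> = (\<Sum>l<mdim M. \<Sum>i<mdim M. chart_jacobian e d p j l * (chart_jacobian c e p l i * y i))"
      unfolding sum_distrib_right by (subst sum.swap) (simp add: mult_ac)
    also have "\<dots> = (\<Sum>l<mdim M. chart_jacobian e d p j l * v e l)"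
      using e by (simp add: v_def sum_distrib_left)
    finally show ?thesis .
  qed
  moreover have "v d \<in> Rn (mdim M)" "d \<notin> atlas M \<or> p \<notin> fst d \<longrightarrow> v d = 0" for d
    by (auto simp: v_def mem_Rn_iff)
  ultimately have "v \<in> tangent_space M p"
    unfolding tangent_space_iff by blast
  moreover have "v c j = y j" for j
  proof (cases "j < mdim M")
    case True
    have "v c j = (\<Sum>i<mdim M. (if i = j then 1 else 0) * y i)"
      using True c partial_chart_self[OF M, of "fst c" "snd c" p]
      by (simp add: v_def chart_jacobian_def)
    also have "\<dots> = (\<Sum>i<mdim M. if i = j then y i else 0)" by (intro sum.cong) auto
    also have "\<dots> = y j" using True by simp
    finally show ?thesis .
  next
    case False
    then show ?thesis using y by (simp add: v_def mem_Rn_iff)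
  qed
  ultimately show thesis using that by blast
qed

section \<open>Complexification and the complex structure\<close>

lemma sum_fun_apply: "(\<Sum>i\<in>I. g i) x = (\<Sum>i\<in>I. g i x)"
  by (induction I rule: infinite_finite_induct) auto

lemma sum_lessThan_double:
  fixes f :: "nat \<Rightarrow> 'a::comm_monoid_add"
  shows "(\<Sum>m<2 * n. f m) = (\<Sum>i<n. f (2 * i) + f (Suc (2 * i)))"
  by (induction n) (simp_all add: add.assoc)

lemma linear_map_on_sum:
  assumes "subspace V" and "linear_map_on V f" and "\<And>i. i \<in> I \<Longrightarrow> w i \<in> V"
  shows "f (\<Sum>i\<in>I. a i *\<^sub>R w i) = (\<Sum>i\<in>I. a i *\<^sub>R f (w i))"
  using assms(3)
proof (induction I rule: infinite_finite_induct)
  case (insert i I)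
  then have "f (a i *\<^sub>R w i + (\<Sum>i\<in>I. a i *\<^sub>R w i)) = f (a i *\<^sub>R w i) + f (\<Sum>i\<in>I. a i *\<^sub>R w i)"
    using assms(1,2) by (simp add: linear_map_on_def subspace_scale subspace_sum)
  then show ?case using insert assms(2) by (simp add: linear_map_on_def)
next
  have "f (0 *\<^sub>R 0) = 0 *\<^sub>R f 0"
    using assms(1,2) subspace_0[OF assms(1)] unfolding linear_map_on_def by blast
  then have f0: "f 0 = 0" by simp
  { case (infinite I) then show ?case using f0 by simp }
  { case empty then show ?case using f0 by simp }
qed

lemma linear_map_on_0: "subspace V \<Longrightarrow> linear_map_on V f \<Longrightarrow> f 0 = 0"
  using linear_map_on_sum[of V f "{}"] by simp

lemma linear_map_on_diff:
  assumes "subspace V" and "linear_map_on V f" and "u \<in> V" "v \<in> V"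
  shows "f (u - v) = f u - f v"
proof -
  have "f (u + (- 1) *\<^sub>R v) = f u + f ((- 1) *\<^sub>R v)"
    using assms unfolding linear_map_on_def by (meson subspace_scale)
  also have "f ((- 1) *\<^sub>R v) = (- 1) *\<^sub>R f v"
    using assms unfolding linear_map_on_def by blast
  finally show ?thesis by simp
qed

lemma subspace_complexify_space:
  assumes "subspace V" shows "cvec.subspace (complexify_space V)"
  using assms
  by (auto simp: cvec.subspace_def complexify_space_def cscale_def mem_Times_iff
      subspace_0 intro!: subspace_add subspace_diff subspace_scale)

lemma complexify_map_add:
  "linear_map_on V f \<Longrightarrow> e \<in> complexify_space V \<Longrightarrow> e' \<in> complexify_space V \<Longrightarrow>
    complexify_map f (e + e') = complexify_map f e + complexify_map f e'"
  by (auto simp: linear_map_on_def complexify_map_def complexify_space_def)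

lemma complexify_map_cscale:
  assumes "subspace V" and "linear_map_on V f" and "e \<in> complexify_space V"
  shows "complexify_map f (cscale z e) = cscale z (complexify_map f e)"
proof -
  have V: "r *\<^sub>R fst e \<in> V" "r *\<^sub>R snd e \<in> V" for r
    using assms(1,3) by (auto simp: complexify_space_def subspace_scale)
  have "f (r *\<^sub>R fst e) = r *\<^sub>R f (fst e)" "f (r *\<^sub>R snd e) = r *\<^sub>R f (snd e)" for r
    using assms(2,3) by (auto simp: linear_map_on_def complexify_space_def)
  moreover have "f (Re z *\<^sub>R snd e + Im z *\<^sub>R fst e) = f (Re z *\<^sub>R snd e) + f (Im z *\<^sub>R fst e)"
    using assms(2) V unfolding linear_map_on_def by blast
  ultimately show ?thesis
    using linear_map_on_diff[OF assms(1,2) V(1) V(2)]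
    by (simp add: complexify_map_def cscale_def map_prod_def split_beta)
qed

section \<open>Real and complex coordinates\<close>

lemma realify_even [simp]: "realify z (2 * i) = Re (z i)"
  and realify_odd [simp]: "realify z (Suc (2 * i)) = Im (z i)"
  by (simp_all add: realify_def)

lemma realify_inject: "realify z = realify w \<longleftrightarrow> z = w"
proof
  assume "realify z = realify w"
  then have "realify z (2 * i) = realify w (2 * i)" "realify z (Suc (2 * i)) = realify w (Suc (2 * i))" for i
    by simp_all
  then show "z = w" by (auto simp: fun_eq_iff complex_eq_iff)
qed simp

text \<open>Every real sequence is thus in the range of \<open>realify\<close>: real coefficients
  can be read as complex ones, two at a time.\<close>

lemma realify_Complex: "realify (\<lambda>i. Complex (r (2 * i)) (r (Suc (2 * i)))) m = r m"
  by (cases "even m") (auto simp: realify_def elim!: evenE oddE)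

lemma inv_into_realify: "inv_into U (\<lambda>p. realify (\<zeta> p)) (realify z) = inv_into U \<zeta> z"
  by (simp add: inv_into_def realify_inject)

text \<open>A real coordinate line is a horizontal or a vertical line in one complex coordinate.
  This relates the real partial derivatives to the complex derivative.\<close>

lemma realify_update_even: "(realify z)(2 * i := s) = realify (z(i := Complex s (Im (z i))))"
  and realify_update_odd: "(realify z)(Suc (2 * i) := s) = realify (z(i := Complex (Re (z i)) s))"
  by (auto simp: realify_def fun_eq_iff elim!: evenE oddE)

lemma has_real_derivative_Re_Im:
  assumes "(h has_field_derivative h') (at (f t))" and "(f has_vector_derivative f') (at t)"
  shows "((\<lambda>s. Re (h (f s))) has_real_derivative Re (f' * h')) (at t)"
    and "((\<lambda>s. Im (h (f s))) has_real_derivative Im (f' * h')) (at t)"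
  unfolding has_real_derivative_iff_has_vector_derivative
  using field_vector_diff_chain_at[OF assms(2,1), unfolded o_def]
  by (rule bounded_linear.has_vector_derivative[OF bounded_linear_Re],
      rule bounded_linear.has_vector_derivative[OF bounded_linear_Im])

text \<open>With all other variables fixed, the transition function \<open>h\<close> has one complex
  derivative \<open>h'\<close>. Along the directions 1 and \<open>\<i>\<close> its derivatives are
  \<open>h'\<close> and \<open>\<i> * h'\<close>, and the equations compare their real and imaginary
  parts.\<close>

lemma Cauchy_Riemann_chart_jacobian:
  assumes X: "complex_manifold X" and c: "c \<in> atlas (underlying X)" "d \<in> atlas (underlying X)"
    and p: "p \<in> fst c" "p \<in> fst d" and ij: "i < cdim X" "j < cdim X"
  shows "chart_jacobian c d p (Suc (2 * j)) (Suc (2 * i)) = chart_jacobian c d p (2 * j) (2 * i)"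
    and "chart_jacobian c d p (Suc (2 * j)) (2 * i) = - chart_jacobian c d p (2 * j) (Suc (2 * i))"
proof -
  obtain U \<zeta> V \<xi> where c': "(U, \<zeta>) \<in> catlas X" "c = (U, \<lambda>p. realify (\<zeta> p))"
    and d': "(V, \<xi>) \<in> catlas X" "d = (V, \<lambda>p. realify (\<xi> p))"
    using c by (auto simp: underlying_def)
  define z where "z = \<zeta> p"
  define h where "h t = \<xi> (inv_into U \<zeta> (z(i := t))) j" for t
  have "\<forall>(U, \<zeta>)\<in>catlas X. \<forall>(V, \<xi>)\<in>catlas X. \<forall>i<cdim X. \<forall>j<cdim X. \<forall>z\<in>\<zeta> ` (U \<inter> V).
        (\<lambda>t. \<xi> (inv_into U \<zeta> (z(i := t))) j) field_differentiable (at (z i))"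
    using X unfolding complex_manifold_def by blast
  from bspec[OF bspec[OF this c'(1), simplified] d'(1)] ij p c' d'
  have "h field_differentiable (at (z i))" by (auto simp: h_def[abs_def] z_def)
  then obtain h' where h': "(h has_field_derivative h') (at (z i))"
    by (auto simp: field_differentiable_def)
  have re: "((\<lambda>s. Complex s (Im (z i))) has_vector_derivative 1) (at (Re (z i)))"
    unfolding Complex_eq by (auto intro!: derivative_eq_intros)
  have im: "((\<lambda>s. Complex (Re (z i)) s) has_vector_derivative \<i>) (at (Im (z i)))"
    unfolding Complex_eq by (auto intro!: derivative_eq_intros)
  have J: "chart_jacobian c d p a b =
      deriv (\<lambda>t. realify (\<xi> (inv_into U (\<lambda>p. realify (\<zeta> p)) ((realify z)(b := t)))) a) (realify z b)" for a b
    by (simp add: chart_jacobian_def partial_def c' d' z_def)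
  have hRe: "(h has_field_derivative h') (at (Complex (Re (z i)) (Im (z i))))" using h' by simp
  note r = has_real_derivative_Re_Im[OF hRe re, unfolded h_def, THEN DERIV_imp_deriv]
  note m = has_real_derivative_Re_Im[OF hRe im, unfolded h_def, THEN DERIV_imp_deriv]
  show "chart_jacobian c d p (Suc (2 * j)) (Suc (2 * i)) = chart_jacobian c d p (2 * j) (2 * i)"
    unfolding J realify_update_even realify_update_odd inv_into_realify realify_even realify_odd r m by simp
  show "chart_jacobian c d p (Suc (2 * j)) (2 * i) = - chart_jacobian c d p (2 * j) (Suc (2 * i))"
    unfolding J realify_update_even realify_update_odd inv_into_realify realify_even realify_odd r m by simp
qed

section \<open>The complex structure and its \<open>-i\<close>-eigenspace\<close>

lemma mdim_underlying [simp]: "mdim (underlying X) = 2 * cdim X"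
  by (simp add: underlying_def)

lemma cx_structure_even [simp]: "cx_structure v c (2 * i) = - v c (Suc (2 * i))"
  and cx_structure_odd [simp]: "cx_structure v c (Suc (2 * i)) = v c (2 * i)"
  by (simp_all add: cx_structure_def)

lemma linear_map_on_cx_structure: "linear_map_on UNIV cx_structure"
  by (auto simp: linear_map_on_def cx_structure_def fun_eq_iff scaleR_fun_def)

lemma cx_structure_cx_structure: "cx_structure (cx_structure v) = - v"
  by (auto simp: cx_structure_def fun_eq_iff)

text \<open>\<open>cx_structure\<close> acts on the components in each chart separately. The result
  transforms as a tangent vector because, by the Cauchy-Riemann equations, the Jacobians commute
  with the complex structure.\<close>

lemma cx_structure_tangent_space:
  assumes X: "complex_manifold X" and v: "v \<in> tangent_space (underlying X) p"
  shows "cx_structure v \<in> tangent_space (underlying X) p"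
  unfolding tangent_space_iff
proof (intro conjI allI ballI impI)
  fix c
  show "cx_structure v c \<in> Rn (mdim (underlying X))"
    using tangent_space_Rn[OF v, of c] by (auto simp: mem_Rn_iff cx_structure_def elim!: oddE)
  assume "c \<notin> atlas (underlying X) \<or> p \<notin> fst c"
  then show "cx_structure v c = 0"
    using tangent_space_off_chart[OF v] by (auto simp: cx_structure_def fun_eq_iff)
next
  fix c d k
  assume c: "c \<in> atlas (underlying X)" and d: "d \<in> atlas (underlying X)"
    and "p \<in> fst c \<and> p \<in> fst d" and k: "k < mdim (underlying X)"
  then have p: "p \<in> fst c" "p \<in> fst d" by auto
  note CR = Cauchy_Riemann_chart_jacobian[OF X c d p]
  obtain j where j: "j < cdim X" "k = 2 * j \<or> k = Suc (2 * j)"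
  proof (rule that[of "k div 2"])
    show "k div 2 < cdim X" using k by simp
    show "k = 2 * (k div 2) \<or> k = Suc (2 * (k div 2))" by presburger
  qed
  have v_eq: "v d m = (\<Sum>i<cdim X. chart_jacobian c d p m (2 * i) * v c (2 * i) +
      chart_jacobian c d p m (Suc (2 * i)) * v c (Suc (2 * i)))" if "m < 2 * cdim X" for m
    using tangent_space_jacobian[OF v c d p, of m] that by (simp add: sum_lessThan_double)
  \<comment> \<open>Both components are expressed through the even row \<open>2 * j\<close> of the
    Jacobian alone; the odd row is eliminated by the Cauchy-Riemann equations.\<close>
  have "v d (2 * j) = (\<Sum>i<cdim X. chart_jacobian c d p (2 * j) (2 * i) * v c (2 * i) +
      chart_jacobian c d p (2 * j) (Suc (2 * i)) * v c (Suc (2 * i)))"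
    "v d (Suc (2 * j)) = (\<Sum>i<cdim X. chart_jacobian c d p (2 * j) (2 * i) * v c (Suc (2 * i)) -
      chart_jacobian c d p (2 * j) (Suc (2 * i)) * v c (2 * i))"
    using v_eq[of "2 * j"] v_eq[of "Suc (2 * j)"] j(1) CR by (auto intro!: sum.cong)
  moreover have "(\<Sum>i<mdim (underlying X). chart_jacobian c d p m i * cx_structure v c i) =
    (\<Sum>i<cdim X. chart_jacobian c d p m (Suc (2 * i)) * v c (2 * i) -
      chart_jacobian c d p m (2 * i) * v c (Suc (2 * i)))" for m
    by (auto simp: sum_lessThan_double intro!: sum.cong)
  ultimately show "cx_structure v d k = (\<Sum>i<mdim (underlying X). chart_jacobian c d p k i * cx_structure v c i)"
    using j CR by (auto simp flip: sum_negf intro!: sum.cong)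
qed

text \<open>For \<open>e = (a, b)\<close> the eigenvalue equation reads \<open>J a = b\<close> and
  \<open>J b = - a\<close>, where \<open>J\<close> is \<open>cx_structure\<close>. The second
  follows from the first since \<open>J\<close> squares to -1, and \<open>b\<close> is tangent
  because \<open>J\<close> preserves tangent spaces.\<close>

lemma T01_iff:
  assumes "complex_manifold X"
  shows "e \<in> T01 X x \<longleftrightarrow> fst e \<in> tangent_space (underlying X) x \<and> snd e = cx_structure (fst e)"
  using cx_structure_tangent_space[OF assms]
  by (cases e) (auto simp: T01_def complexify_space_def complexify_map_def cscale_def cx_structure_cx_structure)

lemma T01_fst_inject:
  "complex_manifold X \<Longrightarrow> e \<in> T01 X x \<Longrightarrow> e' \<in> T01 X x \<Longrightarrow> fst e = fst e' \<Longrightarrow> e = e'"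
  by (simp add: T01_iff prod_eq_iff)

lemma subspace_T01: "cvec.subspace (T01 X x)"
proof -
  note V = subspace_complexify_space[OF subspace_tangent_space[of "underlying X" x]]
  have "complexify_map cx_structure (e + e') = complexify_map cx_structure e + complexify_map cx_structure e'"
    "complexify_map cx_structure (cscale z e) = cscale z (complexify_map cx_structure e)" for e e' z
    using complexify_map_add[OF linear_map_on_cx_structure, of e e']
      complexify_map_cscale[OF _ linear_map_on_cx_structure, of e z]
    by (simp_all add: complexify_space_def)
  note lin = this
  have "complexify_map cx_structure 0 = 0"
    by (simp add: complexify_map_def cx_structure_def fun_eq_iff zero_prod_def)
  then show ?thesis
    unfolding T01_def
    by (intro cvec.subspaceI)
      (use V in \<open>simp_all only: mem_Collect_eq lin cvec.subspace_0 cvec.subspace_add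
        cvec.subspace_scale cvec.scale_zero_right cvec.scale_right_distrib cvec.scale_scale mult.commute\<close>)
qed

section \<open>Lifts to the Courant algebroid\<close>

lemma smooth_section_on_subset:
  "smooth_section_on M E U u \<Longrightarrow> T \<subseteq> U \<Longrightarrow> smooth_section_on M E T u"
  unfolding smooth_section_on_def by (fast intro: smooth_fun_on_subset)

lemma smooth_section_on_component:
  assumes "smooth_section_on M E U u" and "(V, \<Phi>) \<in> trivs E" and "i < rk E"
  shows "smooth_fun_on M (U \<inter> V) (\<lambda>x. \<Phi> x (u x) i)"
proof -
  have "\<forall>(V, \<Phi>)\<in>trivs E. \<forall>i<rk E. smooth_fun_on M (U \<inter> V) (\<lambda>x. \<Phi> x (u x) i)"
    using assms(1) unfolding smooth_section_on_def by (elim conjE)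
  from bspec[OF this assms(2)] assms(3) show ?thesis by simp
qed

lemma smooth_section_on_linear_combination:
  assumes M: "smooth_manifold M" and E: "smooth_vbundle M E" and U: "openin (mtop M) U"
    and f: "\<And>i. i \<in> I \<Longrightarrow> smooth_fun_on M U (f i)"
    and w: "\<And>i. i \<in> I \<Longrightarrow> smooth_section_on M E U (w i)"
  shows "smooth_section_on M E U (\<lambda>x. \<Sum>i\<in>I. f i x *\<^sub>R w i x)"
proof -
  have sub: "subspace (fib E x)" if "x \<in> U" for x
    using E openin_subset[OF U] that by (auto simp: smooth_vbundle_def)
  have wf: "w i x \<in> fib E x" if "i \<in> I" "x \<in> U" for i x
    using w[OF that(1)] that(2) by (auto simp: smooth_section_on_def)
  have "smooth_fun_on M (U \<inter> V) (\<lambda>x. \<Phi> x (\<Sum>i\<in>I. f i x *\<^sub>R w i x) j)"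
    if V: "(V, \<Phi>) \<in> trivs E" and j: "j < rk E" for V \<Phi> j
  proof -
    have oV: "openin (mtop M) V" and lin: "\<And>x. x \<in> V \<Longrightarrow> linear_map_on (fib E x) (\<Phi> x)"
      using E V by (auto simp: smooth_vbundle_def)
    show ?thesis
    proof (rule smooth_fun_on_cong[OF M openin_Int[OF U oV]])
      show "smooth_fun_on M (U \<inter> V) (\<lambda>x. \<Sum>i\<in>I. f i x * \<Phi> x (w i x) j)"
        by (intro smooth_fun_on_sum[OF M openin_Int[OF U oV]]
            smooth_fun_on_mult[OF M openin_Int[OF U oV]] smooth_fun_on_subset[OF f]
            smooth_section_on_component[OF w V j]) auto
      fix x assume "x \<in> U \<inter> V"
      then have "\<Phi> x (\<Sum>i\<in>I. f i x *\<^sub>R w i x) = (\<Sum>i\<in>I. f i x *\<^sub>R \<Phi> x (w i x))"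
        by (intro linear_map_on_sum[OF sub lin] wf) auto
      then show "(\<Sum>i\<in>I. f i x * \<Phi> x (w i x) j) = \<Phi> x (\<Sum>i\<in>I. f i x *\<^sub>R w i x) j"
        by (simp add: sum_fun_apply scaleR_fun_def)
    qed
  qed
  moreover have "(\<Sum>i\<in>I. f i x *\<^sub>R w i x) \<in> fib E x" if "x \<in> U" for x
    using sub[OF that] wf that by (intro subspace_sum subspace_scale) auto
  ultimately show ?thesis by (auto simp: smooth_section_on_def)
qed

lemma smooth_subbundle_frame:
  assumes "smooth_subbundle M E k W" and "x \<in> pts M"
  obtains U w where "openin (mtop M) U" "x \<in> U"
    and "\<And>i. i < k \<Longrightarrow> smooth_section_on M E U (w i)"
    and "\<And>y. y \<in> U \<Longrightarrow> inj_on (\<lambda>i. w i y) {..<k} \<and> independent ((\<lambda>i. w i y) ` {..<k})"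
    and "\<And>y. y \<in> U \<Longrightarrow> span ((\<lambda>i. w i y) ` {..<k}) = W `` {y}"
proof -
  have "\<forall>x\<in>pts M. \<exists>U w. openin (mtop M) U \<and> x \<in> U \<and>
        (\<forall>i<k. smooth_section_on M E U (w i)) \<and>
        (\<forall>y\<in>U. inj_on (\<lambda>i. w i y) {..<k} \<and> independent ((\<lambda>i. w i y) ` {..<k}) \<and>
               span ((\<lambda>i. w i y) ` {..<k}) = W `` {y})"
    using assms(1) unfolding smooth_subbundle_def by (elim conjE)
  from bspec[OF this assms(2)] obtain U w where *: "openin (mtop M) U \<and> x \<in> U \<and>
        (\<forall>i<k. smooth_section_on M E U (w i)) \<and>
        (\<forall>y\<in>U. inj_on (\<lambda>i. w i y) {..<k} \<and> independent ((\<lambda>i. w i y) ` {..<k}) \<and>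
               span ((\<lambda>i. w i y) ` {..<k}) = W `` {y})"
    by (elim exE)
  show thesis
    by (rule that[of U w]) (use * in simp_all)
qed

lemma smooth_complex_subbundle_frame:
  assumes "smooth_complex_subbundle M E k L" and "x \<in> pts M"
  obtains U l where "openin (mtop M) U" "x \<in> U"
    and "\<And>i. i < k \<Longrightarrow> smooth_section_on M E U (\<lambda>y. fst (l i y))"
    and "\<And>i. i < k \<Longrightarrow> smooth_section_on M E U (\<lambda>y. snd (l i y))"
    and "\<And>y. y \<in> U \<Longrightarrow> inj_on (\<lambda>i. l i y) {..<k} \<and> cvec.independent ((\<lambda>i. l i y) ` {..<k})"
    and "\<And>y. y \<in> U \<Longrightarrow> cvec.span ((\<lambda>i. l i y) ` {..<k}) = L `` {y}"
proof -
  have "\<forall>x\<in>pts M. \<exists>U l. openin (mtop M) U \<and> x \<in> U \<and>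
        (\<forall>i<k. smooth_section_on M E U (\<lambda>y. fst (l i y)) \<and> smooth_section_on M E U (\<lambda>y. snd (l i y))) \<and>
        (\<forall>y\<in>U. inj_on (\<lambda>i. l i y) {..<k} \<and> cvec.independent ((\<lambda>i. l i y) ` {..<k}) \<and>
               cvec.span ((\<lambda>i. l i y) ` {..<k}) = L `` {y})"
    using assms(1) unfolding smooth_complex_subbundle_def by (elim conjE)
  from bspec[OF this assms(2)] obtain U l where *: "openin (mtop M) U \<and> x \<in> U \<and>
        (\<forall>i<k. smooth_section_on M E U (\<lambda>y. fst (l i y)) \<and> smooth_section_on M E U (\<lambda>y. snd (l i y))) \<and>
        (\<forall>y\<in>U. inj_on (\<lambda>i. l i y) {..<k} \<and> cvec.independent ((\<lambda>i. l i y) ` {..<k}) \<and>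
               cvec.span ((\<lambda>i. l i y) ` {..<k}) = L `` {y})"
    by (elim exE)
  show thesis
    by (rule that[of U l]) (use * in simp_all)
qed

lemma fst_complexify_map [simp]: "fst (complexify_map f e) = f (fst e)"
  and snd_complexify_map [simp]: "snd (complexify_map f e) = f (snd e)"
  by (simp_all add: complexify_map_def)

text \<open>Interleaved in the order used by \<open>realify\<close>, so that real coefficients match
  complex ones index by index.\<close>

definition real_frame :: "(nat \<Rightarrow> 'v \<times> 'v) \<Rightarrow> nat \<Rightarrow> 'v" where
  "real_frame l m = (if even m then fst (l (m div 2)) else snd (l (m div 2)))"

lemma real_frame_simps [simp]:
  "real_frame l (2 * i) = fst (l i)" "real_frame l (Suc (2 * i)) = snd (l i)"
  by (simp_all add: real_frame_def)

text \<open>The conjugate appears because the real part of \<open>(a - i b) (u + i v)\<close> is \<open>a u + b v\<close>.\<close>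

lemma fst_complex_combination:
  "fst (\<Sum>j<k. cscale (cnj (z j)) (l j)) = (\<Sum>m<2 * k. realify z m *\<^sub>R real_frame l m)"
  by (simp add: sum_lessThan_double fst_sum cscale_def)

text \<open>An independent family of \<open>k\<close> vectors gives its span the dimension
  \<open>k\<close>, and the standard basis gives \<open>Rn n\<close> the dimension \<open>n\<close>.
  This will fix the rank of a lift of \<open>T01\<close>.\<close>

lemma card_basis_Rn:
  fixes w :: "nat \<Rightarrow> nat \<Rightarrow> real"
  assumes ind: "\<And>a. (\<Sum>i<k. a i *\<^sub>R w i) = 0 \<Longrightarrow> \<forall>i<k. a i = 0"
    and span: "range (\<lambda>a. \<Sum>i<k. a i *\<^sub>R w i) = Rn n"
  shows "k = n"
proof -
  have dim: "dim (range (\<lambda>a. \<Sum>i<k. a i *\<^sub>R w i)) = k"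
    if "\<And>a. (\<Sum>i<k. a i *\<^sub>R w i) = 0 \<Longrightarrow> \<forall>i<k. a i = 0" for k and w :: "nat \<Rightarrow> nat \<Rightarrow> real"
  proof -
    have "inj_on w {..<k} \<and> independent (w ` {..<k})"
      using that by (subst real_vector.independent_indexed_iff) auto
    then show ?thesis
      by (metis (no_types) card_image card_lessThan dim_span_eq_card_independent finite_lessThan
          real_vector.span_indexed)
  qed
  have eval: "(\<Sum>i<n. a i *\<^sub>R basis_vec i) = (\<lambda>j. if j < n then a j else 0)" for a
    by (auto simp: fun_eq_iff sum_fun_apply scaleR_fun_def basis_vec_def if_distrib cong: if_cong)
  have "dim (range (\<lambda>a. \<Sum>i<n. a i *\<^sub>R basis_vec i)) = n"
    by (rule dim) (metis eval zero_fun_apply)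
  moreover have "range (\<lambda>a. \<Sum>i<n. a i *\<^sub>R basis_vec i) = Rn n"
    unfolding eval by (auto simp: mem_Rn_iff image_iff fun_eq_iff)
  moreover have "dim (range (\<lambda>a. \<Sum>i<k. a i *\<^sub>R w i)) = k"
    by (rule dim) (rule ind)
  ultimately show ?thesis using span by simp
qed

section \<open>Horizontal lifts and their coordinate frames\<close>

context
  fixes X :: "'x complex_mfd" and E :: "('x, 'v::real_vector) courant"
  assumes X: "complex_manifold X"
    and E: "smooth_vbundle (underlying X) E"
    and anchor: "bundle_map (underlying X) E (tangent_bundle (underlying X)) (anchor E)"
begin

lemma smooth_underlying: "smooth_manifold (underlying X)"
  using X by (simp add: complex_manifold_def)

lemma subspace_fib: "x \<in> pts (underlying X) \<Longrightarrow> subspace (fib E x)"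
  using E by (simp add: smooth_vbundle_def)

lemma anchor_linear: "x \<in> pts (underlying X) \<Longrightarrow> linear_map_on (fib E x) (anchor E x)"
  using anchor by (simp add: bundle_map_def)

lemma anchor_tangent: "x \<in> pts (underlying X) \<Longrightarrow> a \<in> fib E x \<Longrightarrow> anchor E x a \<in> tangent_space (underlying X) x"
  using anchor by (auto simp: bundle_map_def tangent_bundle_def)

lemma anchor_smooth:
  assumes "openin (mtop (underlying X)) U" and "smooth_section_on (underlying X) E U u" and "c \<in> atlas (underlying X)" and "i < mdim (underlying X)"
  shows "smooth_fun_on (underlying X) (U \<inter> fst c) (\<lambda>x. anchor E x (u x) c i)"
proof -
  have "smooth_section_on (underlying X) (tangent_bundle (underlying X)) U (\<lambda>x. anchor E x (u x))"
    using anchor assms(1,2) by (simp add: bundle_map_def)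
  moreover have "(fst c, \<lambda>p v. v c) \<in> trivs (tangent_bundle (underlying X))"
    unfolding tangent_bundle_def vbundle.select_convs using assms(3) by blast
  ultimately show ?thesis
    using smooth_section_on_component[of "underlying X" "tangent_bundle (underlying X)" U _ "fst c" "\<lambda>p v. v c" i] assms(4)
    by (simp add: tangent_bundle_def)
qed

lemma chart_around:
  assumes "x \<in> pts (underlying X)"
  obtains c where "c \<in> atlas (underlying X)" "x \<in> fst c"
proof -
  have "\<Union>(fst ` atlas (underlying X)) = pts (underlying X)" using smooth_underlying by (simp add: smooth_manifold_def)
  then show thesis using assms that by blast
qed

lemma horizontal_lift_fib:
  assumes "horizontal_lift (underlying X) E W" and "x \<in> pts (underlying X)"
  shows "W `` {x} \<subseteq> fib E x" "subspace (W `` {x})"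
  using assms by (auto simp: horizontal_lift_def smooth_subbundle_def)

lemma horizontal_lift_inj:
  assumes W: "horizontal_lift (underlying X) E W" and x: "x \<in> pts (underlying X)"
  shows "inj_on (anchor E x) (W `` {x})"
proof (rule inj_onI)
  fix a b assume ab: "a \<in> W `` {x}" "b \<in> W `` {x}" and eq: "anchor E x a = anchor E x b"
  note fib = horizontal_lift_fib[OF W x]
  have "anchor E x (a - b) = 0"
    using linear_map_on_diff[OF subspace_fib[OF x] anchor_linear[OF x], of a b] ab fib eq by auto
  moreover have "a - b \<in> W `` {x}" using fib(2) ab by (rule subspace_diff)
  ultimately have "a - b \<in> W `` {x} \<inter> ker_anchor E x"
    using fib(1) by (auto simp: ker_anchor_def)
  moreover have "W `` {x} \<inter> ker_anchor E x = {0}"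
    using W x by (simp add: horizontal_lift_def)
  ultimately show "a = b" by auto
qed

text \<open>In a chart the anchor turns a frame of \<open>W\<close> into an invertible matrix; its smooth inverse
  produces the frame of \<open>W\<close> lying over the coordinate vector fields.\<close>

lemma horizontal_lift_coordinate_frame:
  assumes W: "horizontal_lift (underlying X) E W" and x: "x \<in> pts (underlying X)"
  obtains U c s where "openin (mtop (underlying X)) U" "x \<in> U" "c \<in> atlas (underlying X)" "U \<subseteq> fst c"
    and "\<And>m. m < mdim (underlying X) \<Longrightarrow> smooth_section_on (underlying X) E U (s m)"
    and "\<And>m y. m < mdim (underlying X) \<Longrightarrow> y \<in> U \<Longrightarrow> s m y \<in> W `` {y}"
    and "\<And>i m y. i < mdim (underlying X) \<Longrightarrow> m < mdim (underlying X) \<Longrightarrow> y \<in> U \<Longrightarrow> anchor E y (s m y) c i = (if i = m then 1 else 0)"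
proof -
  let ?n = "mdim (underlying X)"
  obtain U0 w where U0: "openin (mtop (underlying X)) U0" "x \<in> U0"
    and w: "\<And>i. i < ?n \<Longrightarrow> smooth_section_on (underlying X) E U0 (w i)"
    and basis: "\<And>y. y \<in> U0 \<Longrightarrow> inj_on (\<lambda>i. w i y) {..<?n} \<and> independent ((\<lambda>i. w i y) ` {..<?n})"
      "\<And>y. y \<in> U0 \<Longrightarrow> span ((\<lambda>i. w i y) ` {..<?n}) = W `` {y}"
  proof -
    have "smooth_subbundle (underlying X) E ?n W" using W by (simp add: horizontal_lift_def)
    from smooth_subbundle_frame[OF this x] show thesis using that by metis
  qed
  obtain c where c: "c \<in> atlas (underlying X)" "x \<in> fst c" using chart_around[OF x] .
  define U where "U = U0 \<inter> fst c"
  have oc: "openin (mtop (underlying X)) (fst c)"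
    using openin_chart_domain[OF smooth_underlying, of "fst c" "snd c"] c by simp
  have U: "openin (mtop (underlying X)) U" "x \<in> U" "U \<subseteq> fst c" "U \<subseteq> U0"
    using U0 c oc by (auto simp: U_def)
  have pts: "y \<in> pts (underlying X)" if "y \<in> U" for y using openin_subset[OF U(1)] that by blast
  have wW: "w i y \<in> W `` {y}" if "i < ?n" "y \<in> U" for i y
    using basis(2)[of y] span_base[of "w i y" "(\<lambda>i. w i y) ` {..<?n}"] that U(4) by auto
  have wf: "w i y \<in> fib E y" if "i < ?n" "y \<in> U" for i y
    using wW[OF that] horizontal_lift_fib(1)[OF W pts[OF that(2)]] by blast
  have lin: "anchor E y (\<Sum>i<?n. a i *\<^sub>R w i y) c j = (\<Sum>i<?n. anchor E y (w i y) c j * a i)"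
    if "y \<in> U" for a y j
  proof -
    have "anchor E y (\<Sum>i<?n. a i *\<^sub>R w i y) = (\<Sum>i<?n. a i *\<^sub>R anchor E y (w i y))"
      by (intro linear_map_on_sum[OF subspace_fib[OF pts[OF that]] anchor_linear[OF pts[OF that]]] wf[OF _ that]) auto
    then show ?thesis by (simp add: sum_fun_apply scaleR_fun_def mult.commute)
  qed
  have combW: "(\<Sum>i<?n. a i *\<^sub>R w i y) \<in> W `` {y}" if "y \<in> U" for a y
    using horizontal_lift_fib(2)[OF W pts[OF that]] wW[OF _ that]
    by (intro subspace_sum subspace_scale) auto
  obtain b where b: "\<And>i j. i < ?n \<Longrightarrow> j < ?n \<Longrightarrow> smooth_fun_on (underlying X) U (b i j)"
    and inv: "\<And>y i j. y \<in> U \<Longrightarrow> i < ?n \<Longrightarrow> j < ?n \<Longrightarrow>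
      (\<Sum>k<?n. anchor E y (w k y) c i * b k j y) = (if i = j then 1 else 0)"
  proof (rule smooth_matrix_right_inverse[OF smooth_underlying U(1), of ?n "\<lambda>i k y. anchor E y (w k y) c i"])
    show "smooth_fun_on (underlying X) U (\<lambda>y. anchor E y (w k y) c i)" if "i < ?n" "k < ?n" for i k
      unfolding U_def by (rule anchor_smooth[OF U0(1) w[OF that(2)] c(1) that(1)])
    \<comment> \<open>A kernel vector of the matrix gives a combination of the frame whose anchor
      vanishes. It is 0 since the anchor is injective on \<open>W\<close>, and then the coefficients
      are 0 by independence.\<close>
    fix y a assume y: "y \<in> U" and zero: "\<And>i. i < ?n \<Longrightarrow> (\<Sum>k<?n. anchor E y (w k y) c i * a k) = 0"
    note py = pts[OF y]
    let ?v = "\<Sum>i<?n. a i *\<^sub>R w i y"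
    have v: "?v \<in> W `` {y}" by (rule combW[OF y])
    then have T: "anchor E y ?v \<in> tangent_space (underlying X) y"
      using horizontal_lift_fib(1)[OF W py] anchor_tangent[OF py] by blast
    have "anchor E y ?v c j = 0" for j
      using tangent_space_Rn[OF T, of c] zero lin[OF y] by (cases "j < ?n") (auto simp: mem_Rn_iff)
    then have "anchor E y ?v c = 0 c" by (simp add: fun_eq_iff)
    then have "anchor E y ?v = 0"
      using tangent_space_chart_inj[OF T subspace_0[OF subspace_tangent_space] c(1)] y U(3) by blast
    also have "0 = anchor E y 0"
      using linear_map_on_0[OF subspace_fib[OF py] anchor_linear[OF py]] by simp
    finally have "?v = 0"
      using inj_onD[OF horizontal_lift_inj[OF W py]] v subspace_0[OF horizontal_lift_fib(2)[OF W py]] by blast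
    then show "\<forall>j<?n. a j = 0"
      using basis(1)[of y] y U(4) real_vector.independent_indexed_iff[of "{..<?n}" "\<lambda>i. w i y"] by auto
  qed blast
  \<comment> \<open>The coefficients are column \<open>m\<close> of the inverse matrix, so that
    \<open>s m\<close> is sent to the \<open>m\<close>-th coordinate field.\<close>
  define s where "s m y = (\<Sum>k<?n. b k m y *\<^sub>R w k y)" for m y
  show thesis
  proof (rule that[OF U(1,2) c(1) U(3)])
    show "smooth_section_on (underlying X) E U (s m)" if "m < ?n" for m
      unfolding s_def using smooth_section_on_subset[OF w U(4)] b that
      by (intro smooth_section_on_linear_combination[OF smooth_underlying E U(1)]) auto
    show "s m y \<in> W `` {y}" if "m < ?n" "y \<in> U" for m y
      unfolding s_def by (rule combW[OF that(2)])
    show "anchor E y (s m y) c i = (if i = m then 1 else 0)" if "i < ?n" "m < ?n" "y \<in> U" for i m y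
      unfolding s_def lin[OF that(3)] by (rule inv[OF that(3,1,2)])
  qed
qed

lemma anchor_sum:
  assumes "x \<in> pts (underlying X)" and "\<And>i. i \<in> I \<Longrightarrow> w i \<in> fib E x"
  shows "anchor E x (\<Sum>i\<in>I. a i *\<^sub>R w i) c j = (\<Sum>i\<in>I. a i * anchor E x (w i) c j)"
proof -
  have "anchor E x (\<Sum>i\<in>I. a i *\<^sub>R w i) = (\<Sum>i\<in>I. a i *\<^sub>R anchor E x (w i))"
    by (rule linear_map_on_sum[OF subspace_fib[OF assms(1)] anchor_linear[OF assms(1)] assms(2)])
  then show ?thesis by (simp add: sum_fun_apply scaleR_fun_def)
qed

text \<open>Injectivity comes from \<open>W\<close> meeting the kernel of the anchor trivially. A
  preimage of \<open>v\<close> is the combination of the coordinate frame whose coefficients are the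
  components of \<open>v\<close> in the chart.\<close>

lemma horizontal_lift_bij:
  assumes W: "horizontal_lift (underlying X) E W" and x: "x \<in> pts (underlying X)"
  shows "bij_betw (anchor E x) (W `` {x}) (tangent_space (underlying X) x)"
  unfolding bij_betw_def
proof
  show "inj_on (anchor E x) (W `` {x})" by (rule horizontal_lift_inj[OF W x])
  note fib = horizontal_lift_fib[OF W x]
  show "anchor E x ` (W `` {x}) = tangent_space (underlying X) x"
  proof (intro subset_antisym subsetI)
    fix v assume "v \<in> anchor E x ` (W `` {x})"
    then show "v \<in> tangent_space (underlying X) x" using fib(1) anchor_tangent[OF x] by blast
  next
    fix v assume v: "v \<in> tangent_space (underlying X) x"
    obtain U c s where U: "openin (mtop (underlying X)) U" "x \<in> U" "c \<in> atlas (underlying X)" "U \<subseteq> fst c"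
      and "\<And>m. m < mdim (underlying X) \<Longrightarrow> smooth_section_on (underlying X) E U (s m)"
      and s: "\<And>m y. m < mdim (underlying X) \<Longrightarrow> y \<in> U \<Longrightarrow> s m y \<in> W `` {y}"
        "\<And>i m y. i < mdim (underlying X) \<Longrightarrow> m < mdim (underlying X) \<Longrightarrow> y \<in> U \<Longrightarrow> anchor E y (s m y) c i = (if i = m then 1 else 0)"
      using horizontal_lift_coordinate_frame[OF W x] by metis
    define a where "a = (\<Sum>m<mdim (underlying X). v c m *\<^sub>R s m x)"
    have a: "a \<in> W `` {x}"
      unfolding a_def using fib(2) s(1) U(2) by (intro subspace_sum subspace_scale) auto
    then have T: "anchor E x a \<in> tangent_space (underlying X) x" using fib(1) anchor_tangent[OF x] by blast
    have "anchor E x a c j = v c j" for j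
    proof (cases "j < mdim (underlying X)")
      case True
      have "anchor E x a c j = (\<Sum>m<mdim (underlying X). v c m * anchor E x (s m x) c j)"
        unfolding a_def using fib(1) s(1) U(2) by (intro anchor_sum[OF x]) blast
      also have "\<dots> = (\<Sum>m<mdim (underlying X). if m = j then v c m else 0)"
        using s(2) True U(2) by (intro sum.cong) auto
      finally show ?thesis using True by simp
    next
      case False
      then show ?thesis
        using tangent_space_Rn[OF T, of c] tangent_space_Rn[OF v, of c] by (simp add: mem_Rn_iff)
    qed
    then have "anchor E x a = v"
      using U by (intro tangent_space_chart_inj[OF T v U(3)]) auto
    then show "v \<in> anchor E x ` (W `` {x})" using a by blast
  qed
qed

section \<open>From horizontal lifts to lifts of \<open>T01\<close>\<close>

lemma lift01_fib:
  "x \<in> pts (underlying X) \<Longrightarrow> lift01 X E W `` {x} =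
    {e \<in> complexify_space (W `` {x}). complexify_map (anchor E x) e \<in> T01 X x}"
  by (auto simp: lift01_def)

text \<open>The complexified anchor is bijective from the complexification of \<open>W\<close> onto
  that of the tangent space, and the fibre of \<open>lift01\<close> is the preimage of
  \<open>T01\<close> under it.\<close>

lemma lift01_bij:
  assumes W: "horizontal_lift (underlying X) E W" and x: "x \<in> pts (underlying X)"
  shows "bij_betw (complexify_map (anchor E x)) (lift01 X E W `` {x}) (T01 X x)"
  unfolding bij_betw_def lift01_fib[OF x]
proof
  note bij = horizontal_lift_bij[OF W x]
  show "inj_on (complexify_map (anchor E x))
      {e \<in> complexify_space (W `` {x}). complexify_map (anchor E x) e \<in> T01 X x}"
    unfolding complexify_space_def complexify_map_def
    by (rule inj_on_subset[OF map_prod_inj_on[OF bij_betw_imp_inj_on[OF bij] bij_betw_imp_inj_on[OF bij]]]) auto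
  have "\<exists>e\<in>complexify_space (W `` {x}). t = complexify_map (anchor E x) e" if "t \<in> T01 X x" for t
  proof -
    have "fst t \<in> anchor E x ` (W `` {x})" "snd t \<in> anchor E x ` (W `` {x})"
      using that bij_betw_imp_surj_on[OF bij] by (auto simp: T01_def complexify_space_def)
    then obtain a b where "a \<in> W `` {x}" "b \<in> W `` {x}" "fst t = anchor E x a" "snd t = anchor E x b"
      by blast
    then show ?thesis
      by (intro bexI[of _ "(a, b)"]) (auto simp: complexify_space_def prod_eq_iff)
  qed
  then show "complexify_map (anchor E x) `
      {e \<in> complexify_space (W `` {x}). complexify_map (anchor E x) e \<in> T01 X x} = T01 X x"
    by blast
qed

text \<open>Equal real parts have equal anchors, an element of \<open>T01\<close> is determined by
  its real part, and the complexified anchor is injective on \<open>S\<close>. The set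
  \<open>S\<close> is left general to cover fibres of \<open>lift01 X E W\<close> and of an
  arbitrary lift.\<close>

lemma lift_fst_inject:
  assumes "bij_betw (complexify_map (anchor E x)) S (T01 X x)"
    and "e \<in> S" "e' \<in> S" "fst e = fst e'"
  shows "e = e'"
proof -
  have "complexify_map (anchor E x) e = complexify_map (anchor E x) e'"
    using assms by (intro T01_fst_inject[OF X, of _ x]) (auto dest: bij_betwE)
  then show ?thesis using assms bij_betw_imp_inj_on inj_onD by metis
qed

text \<open>Given \<open>a\<close> in \<open>W\<close>, a matching imaginary part is the vector of
  \<open>W\<close> whose anchor is \<open>cx_structure\<close> of the anchor of \<open>a\<close>.
  This recovers \<open>W\<close> from its image and so yields injectivity of the
  correspondence.\<close>

lemma fst_image_lift01:
  assumes W: "horizontal_lift (underlying X) E W" and x: "x \<in> pts (underlying X)"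
  shows "fst ` (lift01 X E W `` {x}) = W `` {x}"
proof (intro subset_antisym subsetI)
  fix a assume "a \<in> fst ` (lift01 X E W `` {x})"
  then show "a \<in> W `` {x}" unfolding lift01_fib[OF x] by (auto simp: complexify_space_def)
next
  fix a assume a: "a \<in> W `` {x}"
  note bij = horizontal_lift_bij[OF W x]
  have T: "anchor E x a \<in> tangent_space (underlying X) x" using a bij by (blast dest: bij_betwE)
  then have "cx_structure (anchor E x a) \<in> anchor E x ` (W `` {x})"
    using cx_structure_tangent_space[OF X] bij_betw_imp_surj_on[OF bij] by simp
  then obtain b where b: "b \<in> W `` {x}" "anchor E x b = cx_structure (anchor E x a)" by force
  have "(a, b) \<in> lift01 X E W `` {x}"
    unfolding lift01_fib[OF x] using a b T by (simp add: complexify_space_def T01_iff[OF X])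
  then show "a \<in> fst ` (lift01 X E W `` {x})" by force
qed

lemma subspace_lift01_fib:
  assumes W: "horizontal_lift (underlying X) E W" and x: "x \<in> pts (underlying X)"
  shows "cvec.subspace (lift01 X E W `` {x})"
proof -
  have V: "cvec.subspace (complexify_space (W `` {x}))"
    by (rule subspace_complexify_space[OF horizontal_lift_fib(2)[OF W x]])
  have lin: "linear_map_on (W `` {x}) (anchor E x)"
    using anchor_linear[OF x] horizontal_lift_fib(1)[OF W x] unfolding linear_map_on_def by blast
  have "complexify_map (anchor E x) 0 = 0"
    using linear_map_on_0[OF horizontal_lift_fib(2)[OF W x] lin] by (simp add: prod_eq_iff)
  then show ?thesis
    unfolding lift01_fib[OF x]
    by (intro cvec.subspaceI)
      (use V in \<open>simp_all only: mem_Collect_eq cvec.subspace_0 cvec.subspace_add cvec.subspace_scale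
        complexify_map_add[OF lin] complexify_map_cscale[OF horizontal_lift_fib(2)[OF W x] lin]
        cvec.subspace_0[OF subspace_T01] cvec.subspace_add[OF subspace_T01]
        cvec.subspace_scale[OF subspace_T01]\<close>)
qed

text \<open>The vectors \<open>l j\<close> lie over twice the antiholomorphic coordinate fields of
  the chart. Smoothness is inherited from the coordinate frame \<open>s\<close>, and both frame
  conditions reduce, through real parts, to reading off coefficients with
  \<open>coord\<close>.\<close>

lemma smooth_complex_subbundle_lift01:
  assumes W: "horizontal_lift (underlying X) E W"
  shows "smooth_complex_subbundle (underlying X) E (cdim X) (lift01 X E W)"
  unfolding smooth_complex_subbundle_def
proof (intro conjI ballI)
  have "e \<in> complexify_space (fib E x)" if "(x, e) \<in> lift01 X E W" for x e
    using that horizontal_lift_fib(1)[OF W, of x] by (auto simp: lift01_def complexify_space_def)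
  then show "lift01 X E W \<subseteq> Sigma (pts (underlying X)) (\<lambda>x. complexify_space (fib E x))"
    by (auto simp: lift01_def)
  fix x assume x: "x \<in> pts (underlying X)"
  show "cvec.subspace (lift01 X E W `` {x})" by (rule subspace_lift01_fib[OF W x])
  let ?n = "mdim (underlying X)"
  obtain U c s where U: "openin (mtop (underlying X)) U" "x \<in> U" "c \<in> atlas (underlying X)" "U \<subseteq> fst c"
    and s: "\<And>m. m < ?n \<Longrightarrow> smooth_section_on (underlying X) E U (s m)"
      "\<And>m y. m < ?n \<Longrightarrow> y \<in> U \<Longrightarrow> s m y \<in> W `` {y}"
      "\<And>i m y. i < ?n \<Longrightarrow> m < ?n \<Longrightarrow> y \<in> U \<Longrightarrow> anchor E y (s m y) c i = (if i = m then 1 else 0)"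
    using horizontal_lift_coordinate_frame[OF W x] by metis
  define l where "l j y = (s (2 * j) y, s (Suc (2 * j)) y)" for j y
  have frame: "real_frame (\<lambda>j. l j y) m = s m y" for m y
    by (cases "even m") (auto simp: l_def real_frame_def elim!: evenE oddE)
  show "\<exists>U l. openin (mtop (underlying X)) U \<and> x \<in> U \<and>
    (\<forall>i<cdim X. smooth_section_on (underlying X) E U (\<lambda>y. fst (l i y)) \<and> smooth_section_on (underlying X) E U (\<lambda>y. snd (l i y))) \<and>
    (\<forall>y\<in>U. inj_on (\<lambda>i. l i y) {..<cdim X} \<and> cvec.independent ((\<lambda>i. l i y) ` {..<cdim X}) \<and>
      cvec.span ((\<lambda>i. l i y) ` {..<cdim X}) = lift01 X E W `` {y})"
  proof (rule exI[of _ U], rule exI[of _ l], intro conjI allI impI ballI U(1,2))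
    fix i assume i: "i < cdim X"
    show "smooth_section_on (underlying X) E U (\<lambda>y. fst (l i y))" "smooth_section_on (underlying X) E U (\<lambda>y. snd (l i y))"
      using s(1)[of "2 * i"] s(1)[of "Suc (2 * i)"] i by (simp_all add: l_def)
  next
    fix y assume y: "y \<in> U"
    have py: "y \<in> pts (underlying X)" using openin_subset[OF U(1)] y by blast
    note bij = horizontal_lift_bij[OF W py] and fib = horizontal_lift_fib[OF W py]
      and Lsub = subspace_lift01_fib[OF W py]
    have sW: "s m y \<in> W `` {y}" if "m < ?n" for m using s(2)[OF that y] .
    have coord: "anchor E y (\<Sum>m<?n. a m *\<^sub>R s m y) c j = a j" if j: "j < ?n" for a j
    proof -
      have "anchor E y (\<Sum>m<?n. a m *\<^sub>R s m y) c j = (\<Sum>m<?n. a m * anchor E y (s m y) c j)"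
        using fib(1) sW by (intro anchor_sum[OF py]) blast
      also have "\<dots> = (\<Sum>m<?n. if m = j then a m else 0)"
        using s(3) j y by (intro sum.cong) auto
      finally show ?thesis using j by simp
    qed
    have lL: "l j y \<in> lift01 X E W `` {y}" if j: "j < cdim X" for j
    proof -
      have T: "anchor E y (s m y) \<in> tangent_space (underlying X) y" if "m < ?n" for m
        using bij sW[OF that] by (blast dest: bij_betwE)
      \<comment> \<open>The complex structure takes the coordinate field of index
        \<open>2 * j\<close> to that of index \<open>Suc (2 * j)\<close>. From the dimension on,
        both sides have zero components.\<close>
      have "anchor E y (s (Suc (2 * j)) y) c k = cx_structure (anchor E y (s (2 * j) y)) c k" for k
      proof (cases "k < ?n")
        case True
        define i where "i = k div 2"
        have "k = 2 * i \<or> k = Suc (2 * i)" unfolding i_def by presburger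
        moreover have "i < cdim X" using True by (simp add: i_def)
        ultimately show ?thesis
          using j y by (auto simp: s(3) double_not_eq_Suc_double Suc_double_not_eq_double)
      next
        case False
        then show ?thesis
          using tangent_space_Rn[OF T, of "Suc (2 * j)" c] j
            tangent_space_Rn[OF cx_structure_tangent_space[OF X T], of "2 * j" c]
          by (simp add: mem_Rn_iff)
      qed
      then have "anchor E y (s (Suc (2 * j)) y) = cx_structure (anchor E y (s (2 * j) y))"
        using j y U T cx_structure_tangent_space[OF X T]
        by (intro tangent_space_chart_inj[OF _ _ U(3)]) auto
      then show ?thesis
        unfolding lift01_fib[OF py] using sW j T
        by (simp add: l_def complexify_space_def T01_iff[OF X])
    qed
    have LI: "(\<Sum>j<cdim X. cscale (z j) (l j y)) \<in> lift01 X E W `` {y}" for z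
      using lL by (intro cvec.subspace_sum[OF Lsub] cvec.subspace_scale[OF Lsub]) auto
    have fst_comb: "fst (\<Sum>j<cdim X. cscale (cnj (z j)) (l j y)) = (\<Sum>m<?n. realify z m *\<^sub>R s m y)" for z
      by (simp add: fst_complex_combination frame)
    have "\<forall>j<cdim X. z j = 0" if "(\<Sum>j<cdim X. cscale (z j) (l j y)) = 0" for z
    proof -
      \<comment> \<open>The conjugates undo the conjugation built into
        \<open>fst_comb\<close>.\<close>
      have zero: "(\<Sum>m<?n. realify (\<lambda>j. cnj (z j)) m *\<^sub>R s m y) = 0"
        using fst_comb[of "\<lambda>j. cnj (z j)"] that by simp
      have r0: "realify (\<lambda>j. cnj (z j)) m = 0" if "m < ?n" for m
        using coord[OF that, of "realify (\<lambda>j. cnj (z j))"] unfolding zero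
        by (simp add: linear_map_on_0[OF subspace_fib[OF py] anchor_linear[OF py]])
      have "z j = 0" if "j < cdim X" for j
        using r0[of "2 * j"] r0[of "Suc (2 * j)"] that by (simp add: complex_eq_iff)
      then show ?thesis by blast
    qed
    then have "inj_on (\<lambda>i. l i y) {..<cdim X} \<and> cvec.independent ((\<lambda>i. l i y) ` {..<cdim X})"
      by (subst cvec.independent_indexed_iff) auto
    then show "inj_on (\<lambda>i. l i y) {..<cdim X}" "cvec.independent ((\<lambda>i. l i y) ` {..<cdim X})"
      by auto
    have "e \<in> range (\<lambda>z. \<Sum>j<cdim X. cscale (z j) (l j y))" if e: "e \<in> lift01 X E W `` {y}" for e
    proof -
      have a: "fst e \<in> W `` {y}" using fst_image_lift01[OF W py] e by blast
      \<comment> \<open>The candidate coefficients of \<open>e\<close> are the chart components of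
        the anchor of its real part, taken in pairs. The combination \<open>e'\<close> then has the
        same real part as \<open>e\<close>, hence equals it.\<close>
      define r where "r = anchor E y (fst e) c"
      define z where "z j = Complex (r (2 * j)) (r (Suc (2 * j)))" for j
      have z: "realify z = r" unfolding z_def[abs_def] by (rule ext, rule realify_Complex)
      define e' where "e' = (\<Sum>j<cdim X. cscale (cnj (z j)) (l j y))"
      have e': "e' \<in> lift01 X E W `` {y}" unfolding e'_def by (rule LI)
      have Ta: "anchor E y (fst e) \<in> tangent_space (underlying X) y"
        by (rule bspec[OF bij_betwE[OF bij] a])
      have b: "fst e' \<in> W `` {y}"
        using imageI[OF e', of fst] unfolding fst_image_lift01[OF W py] .
      have Tb: "anchor E y (fst e') \<in> tangent_space (underlying X) y"
        by (rule bspec[OF bij_betwE[OF bij] b])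
      have "anchor E y (fst e') c j = anchor E y (fst e) c j" for j
      proof (cases "j < ?n")
        case True
        show ?thesis unfolding e'_def fst_comb z coord[OF True] by (simp only: r_def)
      next
        case False
        then show ?thesis
          using tangent_space_Rn[OF Ta, of c] tangent_space_Rn[OF Tb, of c] by (simp add: mem_Rn_iff)
      qed
      then have "anchor E y (fst e') c = anchor E y (fst e) c" by (rule ext)
      then have "anchor E y (fst e') = anchor E y (fst e)"
        using subsetD[OF U(4) y] by (intro tangent_space_chart_inj[OF Tb Ta U(3)])
      then have "fst e' = fst e"
        using b a by (rule inj_onD[OF bij_betw_imp_inj_on[OF bij]])
      then have "e' = e" by (rule lift_fst_inject[OF lift01_bij[OF W py] e' e])
      then show ?thesis
        by (intro image_eqI[of _ _ "\<lambda>j. cnj (z j)", OF _ UNIV_I]) (simp only: e'_def)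
    qed
    then show "cvec.span ((\<lambda>i. l i y) ` {..<cdim X}) = lift01 X E W `` {y}"
      using LI by (subst cvec.span_indexed) auto
  qed
qed

section \<open>From lifts of \<open>T01\<close> back to horizontal lifts\<close>

text \<open>Taking real parts is a bijection from \<open>T01\<close> onto the tangent space, and it
  commutes with the anchor.\<close>

lemma anchor_bij_fst_image:
  assumes bij: "bij_betw (complexify_map (anchor E x)) S (T01 X x)"
  shows "bij_betw (anchor E x) (fst ` S) (tangent_space (underlying X) x)"
  unfolding bij_betw_def
proof
  show "inj_on (anchor E x) (fst ` S)"
  proof (rule inj_onI)
    fix a b assume "a \<in> fst ` S" "b \<in> fst ` S" and eq: "anchor E x a = anchor E x b"
    then obtain e e' where e: "e \<in> S" "e' \<in> S" "a = fst e" "b = fst e'" by auto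
    then have "complexify_map (anchor E x) e = complexify_map (anchor E x) e'"
      using eq bij by (intro T01_fst_inject[OF X, of _ x]) (auto dest: bij_betwE)
    then show "a = b" using e inj_onD[OF bij_betw_imp_inj_on[OF bij]] by metis
  qed
  have "fst ` T01 X x = tangent_space (underlying X) x"
  proof (intro subset_antisym subsetI)
    fix v assume "v \<in> tangent_space (underlying X) x"
    then have "(v, cx_structure v) \<in> T01 X x" by (simp add: T01_iff[OF X])
    then show "v \<in> fst ` T01 X x" by (rule image_eqI[rotated]) simp
  qed (auto simp: T01_iff[OF X])
  then show "anchor E x ` fst ` S = tangent_space (underlying X) x"
    unfolding bij_betw_imp_surj_on[OF bij, symmetric] image_image by simp
qed

text \<open>This is the inverse construction. A complex frame of \<open>L\<close> splits into
  \<open>2 * k\<close> real sections that span \<open>W\<close>; they are independent because an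
  element of \<open>L\<close> is determined by its real part. The rank \<open>k\<close> is arbitrary
  at first and is fixed by comparing dimensions with the tangent space.\<close>

lemma fst_isotropic_lift_horizontal:
  assumes L: "smooth_complex_subbundle (underlying X) E k L"
    and bij: "\<And>x. x \<in> pts (underlying X) \<Longrightarrow> bij_betw (complexify_map (anchor E x)) (L `` {x}) (T01 X x)"
  defines "W \<equiv> map_prod id fst ` L"
  shows "horizontal_lift (underlying X) E W" and "lift01 X E W = L"
proof -
  have Wx: "W `` {x} = fst ` (L `` {x})" for x
    unfolding W_def by force
  have LE: "L \<subseteq> Sigma (pts (underlying X)) (\<lambda>x. complexify_space (fib E x))"
    and Lsub: "\<And>x. x \<in> pts (underlying X) \<Longrightarrow> cvec.subspace (L `` {x})"
    using L by (simp_all add: smooth_complex_subbundle_def)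
  have WE: "W \<subseteq> Sigma (pts (underlying X)) (fib E)"
    using LE by (force simp: W_def complexify_space_def)
  have bijW: "bij_betw (anchor E x) (W `` {x}) (tangent_space (underlying X) x)" if "x \<in> pts (underlying X)" for x
    unfolding Wx by (rule anchor_bij_fst_image[OF bij[OF that]])
  have frame: "\<exists>U w. openin (mtop (underlying X)) U \<and> x \<in> U \<and>
        (\<forall>i<mdim (underlying X). smooth_section_on (underlying X) E U (w i)) \<and>
        (\<forall>y\<in>U. inj_on (\<lambda>i. w i y) {..<mdim (underlying X)} \<and> independent ((\<lambda>i. w i y) ` {..<mdim (underlying X)}) \<and>
               span ((\<lambda>i. w i y) ` {..<mdim (underlying X)}) = W `` {y})" if x: "x \<in> pts (underlying X)" for x
  proof -
    obtain U l where U: "openin (mtop (underlying X)) U" "x \<in> U"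
      and l: "\<And>i. i < k \<Longrightarrow> smooth_section_on (underlying X) E U (\<lambda>y. fst (l i y))"
        "\<And>i. i < k \<Longrightarrow> smooth_section_on (underlying X) E U (\<lambda>y. snd (l i y))"
      and basis: "\<And>y. y \<in> U \<Longrightarrow> inj_on (\<lambda>i. l i y) {..<k} \<and> cvec.independent ((\<lambda>i. l i y) ` {..<k})"
        "\<And>y. y \<in> U \<Longrightarrow> cvec.span ((\<lambda>i. l i y) ` {..<k}) = L `` {y}"
      using smooth_complex_subbundle_frame[OF L x] by metis
    have pts: "y \<in> pts (underlying X)" if "y \<in> U" for y using openin_subset[OF U(1)] that by blast
    define w where "w m y = real_frame (\<lambda>i. l i y) m" for m y
    \<comment> \<open>Real combinations of \<open>w\<close> are exactly the real parts of complex
      combinations of \<open>l\<close>; this translation gives both the span and the independence of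
      \<open>w\<close>.\<close>
    have comb: "(\<Sum>m<2 * k. a m *\<^sub>R w m y) =
        fst (\<Sum>j<k. cscale (cnj (Complex (a (2 * j)) (a (Suc (2 * j))))) (l j y))" for a y
      unfolding fst_complex_combination w_def by (simp add: realify_Complex)
    have Lrange: "L `` {y} = range (\<lambda>z. \<Sum>j<k. cscale (z j) (l j y))" if "y \<in> U" for y
      unfolding basis(2)[OF that, symmetric] by (rule cvec.span_indexed) simp
    have range: "range (\<lambda>a. \<Sum>m<2 * k. a m *\<^sub>R w m y) = W `` {y}" if y: "y \<in> U" for y
    proof (intro subset_antisym subsetI)
      fix v assume "v \<in> range (\<lambda>a. \<Sum>m<2 * k. a m *\<^sub>R w m y)"
      then show "v \<in> W `` {y}" unfolding comb Wx Lrange[OF y] by auto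
    next
      fix v assume "v \<in> W `` {y}"
      then obtain z where z: "v = fst (\<Sum>j<k. cscale (z j) (l j y))"
        unfolding Wx Lrange[OF y] by auto
      have "v = (\<Sum>m<2 * k. realify (\<lambda>j. cnj (z j)) m *\<^sub>R w m y)"
        unfolding z w_def by (simp flip: fst_complex_combination)
      then show "v \<in> range (\<lambda>a. \<Sum>m<2 * k. a m *\<^sub>R w m y)"
        by (rule image_eqI[of _ _ "realify (\<lambda>j. cnj (z j))", OF _ UNIV_I])
    qed
    have ind: "\<forall>m<2 * k. a m = 0" if y: "y \<in> U" and zero: "(\<Sum>m<2 * k. a m *\<^sub>R w m y) = 0" for a y
    proof -
      let ?z = "\<lambda>j. cnj (Complex (a (2 * j)) (a (Suc (2 * j))))"
      let ?e = "\<Sum>j<k. cscale (?z j) (l j y)"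
      have "?e \<in> L `` {y}" unfolding Lrange[OF y] by (rule image_eqI[of _ _ ?z, OF refl UNIV_I])
      moreover have "0 \<in> L `` {y}" by (rule cvec.subspace_0[OF Lsub[OF pts[OF y]]])
      moreover have "fst ?e = fst 0" unfolding comb[symmetric] zero by simp
      \<comment> \<open>The complex combination and 0 both lie in \<open>L\<close> and have the same
        real part.\<close>
      ultimately have e0: "?e = 0" by (rule lift_fst_inject[OF bij[OF pts[OF y]]])
      have all: "\<forall>z. (\<Sum>j<k. cscale (z j) (l j y)) = 0 \<longrightarrow> (\<forall>j\<in>{..<k}. z j = 0)"
        using basis(1)[OF y] by (subst (asm) cvec.independent_indexed_iff) auto
      have "\<forall>j\<in>{..<k}. ?z j = 0" by (rule mp[OF spec[OF all, of ?z] e0])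
      then have z: "?z j = 0" if "j < k" for j using that by blast
      have "a m = 0" if "m < 2 * k" for m
      proof -
        define i where "i = m div 2"
        have "i < k" using that by (simp add: i_def)
        from z[OF this] have "a (2 * i) = 0" "a (Suc (2 * i)) = 0"
          by (simp_all add: complex_eq_iff)
        moreover have "m = 2 * i \<or> m = Suc (2 * i)" unfolding i_def by presburger
        ultimately show ?thesis by auto
      qed
      then show ?thesis by blast
    qed
    obtain c where c: "c \<in> atlas (underlying X)" "x \<in> fst c" using chart_around[OF x] .
    have wW: "w m x \<in> W `` {x}" if "m < 2 * k" for m
    proof -
      have "(\<Sum>i<2 * k. (if i = m then 1 else 0) *\<^sub>R w i x) = (\<Sum>i<2 * k. if i = m then w i x else 0)"
        by (intro sum.cong) auto
      then have "w m x = (\<Sum>i<2 * k. (if i = m then 1 else 0) *\<^sub>R w i x)" using that by simp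
      then show ?thesis
        unfolding range[OF U(2), symmetric]
        by (rule image_eqI[of _ _ "\<lambda>i. if i = m then 1 else 0", OF _ UNIV_I])
    qed
    have wE: "w m x \<in> fib E x" if "m \<in> {..<2 * k}" for m
      using wW[of m] that WE by blast
    have ac: "anchor E x (\<Sum>m<2 * k. a m *\<^sub>R w m x) c = (\<Sum>m<2 * k. a m *\<^sub>R anchor E x (w m x) c)" for a
    proof (rule ext)
      fix j
      have "anchor E x (\<Sum>m<2 * k. a m *\<^sub>R w m x) c j = (\<Sum>m<2 * k. a m * anchor E x (w m x) c j)"
        by (rule anchor_sum[OF x wE])
      then show "anchor E x (\<Sum>m<2 * k. a m *\<^sub>R w m x) c j = (\<Sum>m<2 * k. a m *\<^sub>R anchor E x (w m x) c) j"
        by (simp only: sum_fun_apply scaleR_fun_def real_scaleR_def)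
    qed
    \<comment> \<open>The anchor followed by components in the chart \<open>c\<close> is a linear
      bijection from the fibre of \<open>W\<close> onto \<open>Rn (mdim (underlying X))\<close>, so
      it turns the \<open>2 * k\<close> vectors \<open>w m x\<close> into a basis there.\<close>
    have "2 * k = mdim (underlying X)"
    proof (rule card_basis_Rn)
      fix a assume zero: "(\<Sum>m<2 * k. a m *\<^sub>R anchor E x (w m x) c) = 0"
      define v where "v = (\<Sum>m<2 * k. a m *\<^sub>R w m x)"
      have v: "v \<in> W `` {x}"
        unfolding range[OF U(2), symmetric] v_def by (rule image_eqI[of _ _ a, OF refl UNIV_I])
      have 0: "0 \<in> W `` {x}"
        unfolding Wx using cvec.subspace_0[OF Lsub[OF x]] by force
      have T: "anchor E x u \<in> tangent_space (underlying X) x" if "u \<in> W `` {x}" for u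
        by (rule bspec[OF bij_betwE[OF bijW[OF x]] that])
      have "anchor E x v c = anchor E x 0 c"
        unfolding linear_map_on_0[OF subspace_fib[OF x] anchor_linear[OF x]]
        unfolding v_def ac zero by simp
      then have "anchor E x v = anchor E x 0"
        by (rule tangent_space_chart_inj[OF T[OF v] T[OF 0] c])
      then have "v = 0"
        using v 0 by (rule inj_onD[OF bij_betw_imp_inj_on[OF bijW[OF x]]])
      then show "\<forall>m<2 * k. a m = 0" unfolding v_def by (rule ind[OF U(2)])
    next
      have "range (\<lambda>a. \<Sum>m<2 * k. a m *\<^sub>R anchor E x (w m x) c) = (\<lambda>v. v c) ` anchor E x ` (W `` {x})"
        unfolding range[OF U(2), symmetric] image_image ac ..
      also have "\<dots> = (\<lambda>v. v c) ` tangent_space (underlying X) x"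
        by (simp only: bij_betw_imp_surj_on[OF bijW[OF x]])
      also have "\<dots> = Rn (mdim (underlying X))"
      proof (intro subset_antisym subsetI)
        fix u assume "u \<in> Rn (mdim (underlying X))"
        then obtain v where "v \<in> tangent_space (underlying X) x" "v c = u"
          using tangent_space_chart_surj[OF smooth_underlying c] by metis
        then show "u \<in> (\<lambda>v. v c) ` tangent_space (underlying X) x" by blast
      qed (elim imageE, simp only: tangent_space_Rn)
      finally show "range (\<lambda>a. \<Sum>m<2 * k. a m *\<^sub>R anchor E x (w m x) c) = Rn (mdim (underlying X))" .
    qed
    note k = this[symmetric]
    show ?thesis
      unfolding k
    proof (rule exI[of _ U], rule exI[of _ w], intro conjI allI impI ballI U)
      fix m assume "m < 2 * k"
      then show "smooth_section_on (underlying X) E U (w m)"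
        using l[of "m div 2"] by (cases "even m") (simp_all add: w_def[abs_def] real_frame_def)
    next
      fix y assume y: "y \<in> U"
      have "inj_on (\<lambda>i. w i y) {..<2 * k} \<and> independent ((\<lambda>i. w i y) ` {..<2 * k})"
        using ind[OF y] by (subst real_vector.independent_indexed_iff) auto
      then show "inj_on (\<lambda>i. w i y) {..<2 * k}" "independent ((\<lambda>i. w i y) ` {..<2 * k})" by auto
      show "span ((\<lambda>i. w i y) ` {..<2 * k}) = W `` {y}"
        using range[OF y] by (subst real_vector.span_indexed) auto
    qed
  qed
  have sub: "subspace (W `` {x})" if x: "x \<in> pts (underlying X)" for x
    using frame[OF x] subspace_span by metis
  have "W `` {x} \<inter> ker_anchor E x = {0}" if x: "x \<in> pts (underlying X)" for x
  proof -
    note 0 = subspace_0[OF sub[OF x]] linear_map_on_0[OF subspace_fib[OF x] anchor_linear[OF x]]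
      subspace_0[OF subspace_fib[OF x]]
    have "a = 0" if "a \<in> W `` {x}" "anchor E x a = 0" for a
      using inj_onD[OF bij_betw_imp_inj_on[OF bijW[OF x]], of a 0] that 0 by simp
    then show ?thesis using 0 by (auto simp: ker_anchor_def)
  qed
  then show "horizontal_lift (underlying X) E W"
    using WE sub frame by (simp add: horizontal_lift_def smooth_subbundle_def)
  have snd_e: "snd e \<in> W `` {x}" if "x \<in> pts (underlying X)" "e \<in> L `` {x}" for x e
  proof -
    have "cscale (- \<i>) e \<in> L `` {x}" by (rule cvec.subspace_scale[OF Lsub[OF that(1)] that(2)])
    moreover have "fst (cscale (- \<i>) e) = snd e" by (simp add: cscale_def)
    ultimately show ?thesis unfolding Wx by (metis image_eqI)
  qed
  have fib: "lift01 X E W `` {x} = L `` {x}" if x: "x \<in> pts (underlying X)" for x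
  proof (intro subset_antisym subsetI)
    fix e assume e: "e \<in> L `` {x}"
    then have "fst e \<in> W `` {x}" unfolding Wx by blast
    moreover have "complexify_map (anchor E x) e \<in> T01 X x" using bij[OF x] e by (blast dest: bij_betwE)
    ultimately show "e \<in> lift01 X E W `` {x}"
      unfolding lift01_fib[OF x] using snd_e[OF x e] by (simp add: complexify_space_def mem_Times_iff)
  next
    fix e assume "e \<in> lift01 X E W `` {x}"
    then have e: "fst e \<in> W `` {x}" "snd e \<in> W `` {x}" "complexify_map (anchor E x) e \<in> T01 X x"
      unfolding lift01_fib[OF x] by (auto simp: complexify_space_def)
    then obtain e' where e': "e' \<in> L `` {x}" "fst e = fst e'" unfolding Wx by auto
    then have T: "complexify_map (anchor E x) e' \<in> T01 X x" using bij[OF x] by (blast dest: bij_betwE)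
    \<comment> \<open>Both sides are \<open>cx_structure\<close> of the anchor of the common real
      part. Both imaginary parts lie in \<open>W\<close>, where the anchor is injective.\<close>
    have "anchor E x (snd e) = anchor E x (snd e')"
      using T e(3) e'(2) by (simp add: T01_iff[OF X])
    then have "snd e = snd e'"
      using inj_onD[OF bij_betw_imp_inj_on[OF bijW[OF x]]] e(2) snd_e[OF x e'(1)] by blast
    then have "e = e'" using e'(2) by (simp add: prod_eq_iff)
    then show "e \<in> L `` {x}" using e'(1) by simp
  qed
  \<comment> \<open>Relations are compared as sets of pairs, so the fibres off the manifold must
    agree as well.\<close>
  have "L `` {x} = {}" "lift01 X E W `` {x} = {}" if "x \<notin> pts (underlying X)" for x
    using that LE by (auto simp: lift01_def)
  then have "lift01 X E W `` {x} = L `` {x}" for x using fib by (cases "x \<in> pts (underlying X)") auto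
  then show "lift01 X E W = L" by (auto simp: set_eq_iff)
qed

section \<open>The bijection\<close>

lemma horizontal_lift_eqI:
  assumes W: "horizontal_lift (underlying X) E W" and W': "horizontal_lift (underlying X) E W'"
    and eq: "lift01 X E W = lift01 X E W'"
  shows "W = W'"
proof -
  have "W `` {x} = W' `` {x}" for x
  proof (cases "x \<in> pts (underlying X)")
    case True
    then show ?thesis using fst_image_lift01[OF W] fst_image_lift01[OF W'] eq by metis
  next
    case False
    moreover have "W \<subseteq> Sigma (pts (underlying X)) (fib E)" "W' \<subseteq> Sigma (pts (underlying X)) (fib E)"
      using W W' by (simp_all add: horizontal_lift_def smooth_subbundle_def)
    ultimately show ?thesis by blast
  qed
  then show ?thesis by (auto simp: set_eq_iff)
qed

lemma bij_betw_lift01: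
  "bij_betw (lift01 X E) (horizontal_lifts_isotropic01 X E) (isotropic_lifts X E)"
  unfolding bij_betw_def
proof
  show "inj_on (lift01 X E) (horizontal_lifts_isotropic01 X E)"
    by (rule inj_onI) (simp add: horizontal_lifts_isotropic01_def horizontal_lift_eqI)
  show "lift01 X E ` horizontal_lifts_isotropic01 X E = isotropic_lifts X E"
  proof (intro subset_antisym subsetI)
    fix L assume "L \<in> lift01 X E ` horizontal_lifts_isotropic01 X E"
    then show "L \<in> isotropic_lifts X E"
      using smooth_complex_subbundle_lift01 lift01_bij
      by (auto simp: horizontal_lifts_isotropic01_def isotropic_lifts_def)
  next
    fix L assume "L \<in> isotropic_lifts X E"
    then obtain k where L: "smooth_complex_subbundle (underlying X) E k L" "isotropic (underlying X) E L"
      and bij: "\<And>x. x \<in> pts (underlying X) \<Longrightarrow> bij_betw (complexify_map (anchor E x)) (L `` {x}) (T01 X x)"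
      by (auto simp: isotropic_lifts_def)
    note W = fst_isotropic_lift_horizontal[OF L(1) bij]
    \<comment> \<open>On both sides isotropy is a condition on the same subbundle, since the lift
      built from the real parts of \<open>L\<close> is \<open>L\<close> again.\<close>
    have "map_prod id fst ` L \<in> horizontal_lifts_isotropic01 X E"
      using W L(2) by (simp add: horizontal_lifts_isotropic01_def)
    then show "L \<in> lift01 X E ` horizontal_lifts_isotropic01 X E"
      using W(2) by (metis image_eqI)
  qed
qed

end

theorem lemma5p5:
  fixes X :: "'x complex_mfd"
    and K :: "'k monoid" and KM :: "'k manifold"
    and B :: "'k tvec \<Rightarrow> 'k tvec \<Rightarrow> real"
    and E :: "('x, 'v::real_vector) courant"
    and P :: "('p, 'x, 'k) principal"
    and \<rho> :: "'x \<Rightarrow> 'v \<Rightarrow> 'p \<Rightarrow> 'p tvec"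
  assumes "complex_manifold X" and "compact_space (ctop X)"
    and "lie_group K KM" and "compact_space (mtop KM)"
    and "invariant_form K KM B"
    and "real_string_algebroid (underlying X) K KM B E P \<rho>"
  shows "bij_betw (lift01 X E) (horizontal_lifts_isotropic01 X E) (isotropic_lifts X E)"
proof -
  have "courant_algebroid (underlying X) E"
    using assms(6) unfolding real_string_algebroid_def by (elim conjE)
  then have "smooth_vbundle (underlying X) E \<and>
      bundle_map (underlying X) E (tangent_bundle (underlying X)) (anchor E)"
    unfolding courant_algebroid_def by (elim conjE) (intro conjI)
  then show ?thesis by (elim conjE) (rule bij_betw_lift01[OF assms(1)])
qed

end
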